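(* Let $k\ge 1$ be an integer and let $G$ be a finite simple $2$-connected non-bipartite graph which is not $3$-connected. If the minimum degree of $G$ is at least $k+1$, then $G$ contains $\lceil k/2\rceil$ cycles with consecutive odd lengths, i.e. there is an odd integer $\ell$ such that $G$ contains, for each $i\in\{0,1,\dots,\lceil k/2\rceil-1\}$, a cycle of length $\ell+2i$.
   Context: All graphs are finite, simple and undirected. The length of a cycle is its number of edges. *)

theory Defs
  imports Complex_Main "Graph_Theory.Digraph_Component"
begin

text \<open>
  A finite simple undirected graph is a \<^locale>\<open>pair_graph\<close>: a finite loop-free symmetric digraph
  without parallel arcs, in which each undirected edge is represented by its two orientations.
\<close>

text \<open>
  By symmetry the out-degree of a vertex is the number of its neighbours. The minimum is taken over
  a finite set, and is meaningful only for a nonempty vertex set.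
\<close>

definition min_degree :: "('a, 'b) pre_digraph \<Rightarrow> nat" where
  "min_degree G = Min (out_degree G ` verts G)"

definition bipartite :: "('a, 'b) pre_digraph \<Rightarrow> bool" where
  "bipartite G \<longleftrightarrow>
     (\<exists>A B. A \<union> B = verts G \<and> A \<inter> B = {} \<and> arcs_ends G \<subseteq> A \<times> B \<union> B \<times> A)"

definition vertex_connected :: "nat \<Rightarrow> ('a, 'b) pre_digraph \<Rightarrow> bool" where
  "vertex_connected k G \<longleftrightarrow>
     k < card (verts G) \<and>
     (\<forall>S \<subseteq> verts G. card S < k \<longrightarrow> connected (G \<restriction> (verts G - S)))"

text \<open>
  The bound excludes the directed 2-cycles formed by the two orientations of a single edge, which
  \<^const>\<open>pre_digraph.cycle\<close> admits. A directed cycle of length at least 3 traverses pairwise distinct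
  undirected edges, so its length is the number of edges of the undirected cycle.
\<close>

definition has_cycle_of_length :: "('a, 'b) pre_digraph \<Rightarrow> nat \<Rightarrow> bool" where
  "has_cycle_of_length G n \<longleftrightarrow> 3 \<le> n \<and> (\<exists>p. pre_digraph.cycle G p \<and> length p = n)"

end

theory Submission
  imports Defs
begin

text \<open>
  Let \<open>m = \<lceil>k/2\<rceil>\<close>, so that all degrees are at least \<open>2m\<close>, let \<open>{x, y}\<close> be a separating pair,
  and let \<open>A\<close>, \<open>B\<close> be the two sides. The main point is that each side contains \<open>m\<close> paths from \<open>x\<close>
  to \<open>y\<close> whose lengths form an arithmetic progression with difference 2. If one side has \<open>x\<close>-\<open>y\<close>
  paths of both parities, one of them closes the family of the other side to odd cycles. Otherwise
  both sides are bipartite, and since the whole graph is not, a path of one side, or the edge \<open>xy\<close>,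
  has the parity that turns the family of the other side into odd cycles.

  The path families are found by induction on the number of vertices, for graphs that become
  2-connected when \<open>xy\<close> is added. Choose a complete bipartite subgraph with classes \<open>X\<close>
  containing \<open>x\<close> but not \<open>y\<close>, and \<open>Y\<close> the common neighbourhood of \<open>X\<close>, such that
  \<open>s = |X| \<le> |Y|\<close> is maximal. By maximality a vertex outside has at most \<open>s - 1\<close> neighbours in \<open>X\<close>
  and at most \<open>s\<close> in \<open>Y\<close>, so contracting the subgraph costs at most \<open>2s - 2\<close> degrees, while the
  \<open>s\<close> lengths \<open>1, 3, \<dots>, 2s - 1\<close> of paths from \<open>x\<close> to a vertex of \<open>Y\<close> gain \<open>s - 1\<close> further
  path lengths. The induction also demands that all paths of the family share their last edge,
  which makes contraction at \<open>y\<close> possible. Choosing the component of \<open>y\<close> outside the subgraph as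
  large as possible handles the configurations in which this component is useless.
\<close>

section \<open>Simple paths\<close>

text \<open>Deleting each visited vertex from \<open>A\<close> keeps the path simple without a
  vertex list, so \<open>A\<close> only bounds the vertices used. Edges carry lengths, possibly
  several for one pair, because contracting an edge in the parity argument lengthens other
  edges.\<close>

inductive wpath :: "('a \<Rightarrow> 'a \<Rightarrow> nat \<Rightarrow> bool) \<Rightarrow> 'a set \<Rightarrow> 'a \<Rightarrow> 'a \<Rightarrow> nat \<Rightarrow> bool"
  for E where
  wpath_refl: "u \<in> A \<Longrightarrow> wpath E A u u 0"
| wpath_step: "u \<in> A \<Longrightarrow> E u v k \<Longrightarrow> wpath E (A - {u}) v w n \<Longrightarrow> wpath E A u w (k + n)"

lemma wpath_endpoints: "wpath E A u v n \<Longrightarrow> u \<in> A \<and> v \<in> A"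
  by (induction rule: wpath.induct) auto

lemma wpath_mono: "wpath E A u v n \<Longrightarrow> A \<subseteq> B \<Longrightarrow> wpath E B u v n"
proof (induction arbitrary: B rule: wpath.induct)
  case (wpath_step u A v k w n)
  then have "wpath E (B - {u}) v w n" by (meson Diff_mono subset_refl)
  then show ?case by (rule wpath.wpath_step[rotated 2]) (use wpath_step in auto)
qed (auto intro: wpath_refl)

lemma wpath_mono_rel:
  "wpath E A u v n \<Longrightarrow> (\<And>a b k. a \<in> A \<Longrightarrow> b \<in> A \<Longrightarrow> E a b k \<Longrightarrow> F a b k) \<Longrightarrow> wpath F A u v n"
proof (induction rule: wpath.induct)
  case (wpath_step u A v k w n)
  have "v \<in> A" using wpath_endpoints[OF wpath_step(3)] by auto
  then show ?case by (intro wpath.wpath_step[of u A F v]) (use wpath_step in auto)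
qed (auto intro: wpath_refl)

lemma wpath_append:
  "wpath E A u v n \<Longrightarrow> wpath E B v w k \<Longrightarrow> A \<inter> B \<subseteq> {v} \<Longrightarrow> wpath E (A \<union> B) u w (n + k)"
proof (induction rule: wpath.induct)
  case (wpath_refl u A)
  then show ?case by (auto intro: wpath_mono)
next
  case (wpath_step u A v' j v n)
  have "v \<in> A - {u}" using wpath_endpoints[OF wpath_step(3)] by auto
  then have "u \<notin> B" using wpath_step by auto
  then have eq: "A \<union> B - {u} = (A - {u}) \<union> B" by auto
  have "wpath E (A \<union> B - {u}) v' w (n + k)"
    unfolding eq using wpath_step by (intro wpath_step.IH) auto
  then have "wpath E (A \<union> B) u w (j + (n + k))"
    by (rule wpath.wpath_step[rotated 2]) (use wpath_step in auto)
  then show ?case by (simp add: add.assoc)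
qed

lemma wpath_edge: "E u v k \<Longrightarrow> u \<noteq> v \<Longrightarrow> wpath E {u, v} u v k"
  using wpath_step[of u "{u,v}" E v k v 0] by (auto intro: wpath_refl)

lemma wpath_rev:
  assumes "\<And>a b k. E a b k \<Longrightarrow> E b a k"
  shows "wpath E A u v n \<Longrightarrow> wpath E A v u n"
proof (induction rule: wpath.induct)
  case (wpath_step u A v k w n)
  have "v \<in> A - {u}" using wpath_endpoints[OF wpath_step(3)] by auto
  then have "wpath E {v, u} v u k" using wpath_edge[of E v u k] assms wpath_step by auto
  with wpath_step have "wpath E ((A - {u}) \<union> {v, u}) w u (n + k)"
    by (intro wpath_append[of E "A - {u}"]) auto
  moreover have "(A - {u}) \<union> {v, u} = A" using \<open>v \<in> A - {u}\<close> wpath_step by auto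
  ultimately show ?case by (simp add: add.commute)
qed (auto intro: wpath_refl)

lemma wpath_closed:
  "wpath E A u v n \<Longrightarrow> u \<in> C \<Longrightarrow> (\<And>a b k. a \<in> C \<Longrightarrow> b \<in> A \<Longrightarrow> E a b k \<Longrightarrow> b \<in> C) \<Longrightarrow> v \<in> C"
proof (induction rule: wpath.induct)
  case (wpath_step u A v k w n)
  have "v \<in> A - {u}" using wpath_endpoints[OF wpath_step(3)] by auto
  then show ?case using wpath_step by (metis DiffD1)
qed auto

text \<open>Since \<open>w\<close> may already lie on the path, the edge cannot always be appended;
  the recursion stops as soon as it meets \<open>w\<close>.\<close>

lemma wpath_extend:
  "wpath E A u v n \<Longrightarrow> E v w k \<Longrightarrow> w \<in> A \<Longrightarrow> \<exists>j. wpath E A u w j"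
proof (induction rule: wpath.induct)
  case (wpath_refl u A)
  show ?case
  proof (cases "w = u")
    case True then show ?thesis using wpath_refl by (blast intro: wpath.wpath_refl)
  next
    case False
    then have "wpath E {u, w} u w k" using wpath_refl by (auto intro: wpath_edge)
    then show ?thesis using wpath_refl wpath_mono[of E "{u,w}" u w k A] by auto
  qed
next
  case (wpath_step u A v k' v' n)
  show ?case
  proof (cases "w = u")
    case True then show ?thesis using wpath_step(1) by (blast intro: wpath.wpath_refl)
  next
    case False
    then obtain j where "wpath E (A - {u}) v w j" using wpath_step by auto
    then show ?thesis using wpath_step(1,2) by (blast intro: wpath.wpath_step)
  qed
qed

definition spath :: "('a \<Rightarrow> 'a \<Rightarrow> bool) \<Rightarrow> 'a set \<Rightarrow> 'a \<Rightarrow> 'a \<Rightarrow> nat \<Rightarrow> bool" where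
  "spath E = wpath (\<lambda>u v k. E u v \<and> k = 1)"

lemma spath_refl: "u \<in> A \<Longrightarrow> spath E A u u 0"
  by (simp add: spath_def wpath_refl)

lemma spath_step: "u \<in> A \<Longrightarrow> E u v \<Longrightarrow> spath E (A - {u}) v w n \<Longrightarrow> spath E A u w (Suc n)"
  unfolding spath_def using wpath_step[of u A _ v 1 w n] by simp

lemma spath_cases:
  assumes "spath E A u w n"
  obtains "u = w" "n = 0" "u \<in> A"
  | v k where "n = Suc k" "u \<in> A" "E u v" "spath E (A - {u}) v w k"
  using assms unfolding spath_def by (cases rule: wpath.cases) auto

lemma spath_induct [consumes 1, case_names refl step]:
  assumes "spath E A u v n"
    and "\<And>u A. u \<in> A \<Longrightarrow> P A u u 0"
    and "\<And>u A v w n. u \<in> A \<Longrightarrow> E u v \<Longrightarrow> spath E (A - {u}) v w n \<Longrightarrow> P (A - {u}) v w n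
      \<Longrightarrow> P A u w (Suc n)"
  shows "P A u v n"
  using assms(1) unfolding spath_def
  by (induction rule: wpath.induct) (use assms(2,3) in \<open>auto simp: spath_def\<close>)

lemma spath_endpoints: "spath E A u v n \<Longrightarrow> u \<in> A" "spath E A u v n \<Longrightarrow> v \<in> A"
  unfolding spath_def by (auto dest: wpath_endpoints)

lemma spath_mono: "spath E A u v n \<Longrightarrow> A \<subseteq> B \<Longrightarrow> spath E B u v n"
  unfolding spath_def by (rule wpath_mono)

lemma spath_mono_rel:
  "spath E A u v n \<Longrightarrow> (\<And>a b. a \<in> A \<Longrightarrow> b \<in> A \<Longrightarrow> E a b \<Longrightarrow> F a b) \<Longrightarrow> spath F A u v n"
  unfolding spath_def by (erule wpath_mono_rel) auto

lemma spath_append: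
  "spath E A u v n \<Longrightarrow> spath E B v w k \<Longrightarrow> A \<inter> B \<subseteq> {v} \<Longrightarrow> spath E (A \<union> B) u w (n + k)"
  unfolding spath_def by (rule wpath_append)

lemma spath_edge: "E u v \<Longrightarrow> u \<noteq> v \<Longrightarrow> spath E {u, v} u v 1"
  unfolding spath_def by (rule wpath_edge) auto

lemma spath_rev: "symp E \<Longrightarrow> spath E A u v n \<Longrightarrow> spath E A v u n"
  unfolding spath_def by (rule wpath_rev) (auto dest: sympD)

lemma spath_closed:
  "spath E A u v n \<Longrightarrow> u \<in> C \<Longrightarrow> (\<And>a b. a \<in> C \<Longrightarrow> b \<in> A \<Longrightarrow> E a b \<Longrightarrow> b \<in> C) \<Longrightarrow> v \<in> C"
  unfolding spath_def by (erule wpath_closed) auto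

lemma spath_extend: "spath E A u v n \<Longrightarrow> E v w \<Longrightarrow> w \<in> A \<Longrightarrow> \<exists>j. spath E A u w j"
  unfolding spath_def by (erule wpath_extend) auto

lemma spath_join:
  assumes "spath E A u v n" "E v v'" "spath E B v' w k" "A \<inter> B = {}"
  shows "spath E (A \<union> B) u w (Suc (n + k))"
proof -
  have v: "v \<in> A" "v' \<in> B" using assms spath_endpoints by metis+
  then have "v \<noteq> v'" "v \<notin> B" using assms by auto
  then have "spath E (insert v B) v w (Suc k)"
    using assms by (intro spath_step[of v _ E v']) auto
  then have "spath E (A \<union> insert v B) u w (n + Suc k)"
    using assms by (intro spath_append[of E A u v]) auto
  then show ?thesis using v by (simp add: insert_absorb)
qed

lemma spath_split_last:
  assumes "symp E" "spath E A u v n" "u \<noteq> v"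
  obtains w k where "n = Suc k" "spath E (A - {v}) u w k" "E w v"
proof -
  from spath_rev[OF assms(1,2)] show ?thesis
  proof (cases rule: spath_cases)
    case (2 w k)
    show ?thesis
      using that[OF 2(1) spath_rev[OF assms(1) 2(4)]] sympD[OF assms(1) 2(3)] by blast
  qed (use assms in auto)
qed

section \<open>Reachability inside a vertex set\<close>

definition joined :: "('a \<Rightarrow> 'a \<Rightarrow> bool) \<Rightarrow> 'a set \<Rightarrow> 'a \<Rightarrow> 'a \<Rightarrow> bool" where
  "joined E A u v \<longleftrightarrow> (\<exists>n. spath E A u v n)"

lemma joined_refl: "u \<in> A \<Longrightarrow> joined E A u u"
  unfolding joined_def using spath_refl by metis

lemma joined_sym: "symp E \<Longrightarrow> joined E A u v \<Longrightarrow> joined E A v u"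
  unfolding joined_def using spath_rev by metis

lemma joined_extend: "joined E A u v \<Longrightarrow> E v w \<Longrightarrow> w \<in> A \<Longrightarrow> joined E A u w"
  unfolding joined_def using spath_extend by metis

lemma joined_extend_left: "symp E \<Longrightarrow> joined E A u v \<Longrightarrow> E w u \<Longrightarrow> w \<in> A \<Longrightarrow> joined E A w v"
  by (meson joined_extend joined_sym sympD)

lemma joined_closed:
  "joined E A u v \<Longrightarrow> u \<in> C \<Longrightarrow> (\<And>a b. a \<in> C \<Longrightarrow> b \<in> A \<Longrightarrow> E a b \<Longrightarrow> b \<in> C) \<Longrightarrow> v \<in> C"
  unfolding joined_def by (elim exE) (erule spath_closed, auto)

text \<open>If no edge led from \<open>S\<close> to the rest of the component of \<open>c\<close>,
  that rest, which contains \<open>c\<close>, would be closed under edges and so contain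
  \<open>S\<close> as well.\<close>

lemma joined_leaves:
  assumes "symp E" "c \<in> A" "S \<subseteq> {v \<in> A. joined E A v c}" "S \<noteq> {}" "c \<notin> S"
  shows "\<exists>u\<in>S. \<exists>t\<in>{v \<in> A. joined E A v c} - S. E u t"
proof (rule ccontr)
  assume neg: "\<not> ?thesis"
  obtain v where v: "v \<in> S" using assms by auto
  then have "joined E A c v" using assms by (auto intro: joined_sym)
  moreover have "c \<in> {v \<in> A. joined E A v c} - S" using assms by (auto intro: joined_refl)
  ultimately have "v \<in> {v \<in> A. joined E A v c} - S"
  proof (rule joined_closed)
    fix a b assume "a \<in> {v \<in> A. joined E A v c} - S" "b \<in> A" "E a b"
    then show "b \<in> {v \<in> A. joined E A v c} - S"
      using neg assms(1) by (auto intro: joined_extend_left dest: sympD)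
  qed
  then show False using v by auto
qed

section \<open>Families of paths with lengths in arithmetic progression\<close>

definition prog_paths :: "('a \<Rightarrow> 'a \<Rightarrow> bool) \<Rightarrow> 'a set \<Rightarrow> 'a \<Rightarrow> 'a \<Rightarrow> nat \<Rightarrow> bool" where
  "prog_paths E A u v m \<longleftrightarrow> (\<exists>l. \<forall>i<m. spath E A u v (l + 2 * i))"

lemma prog_paths_mono: "prog_paths E A u v m \<Longrightarrow> A \<subseteq> B \<Longrightarrow> n \<le> m \<Longrightarrow> prog_paths E B u v n"
  unfolding prog_paths_def by (meson less_le_trans spath_mono)

lemma prog_paths_append:
  assumes "prog_paths E A u v m" "spath E B v w k" "A \<inter> B \<subseteq> {v}"
  shows "prog_paths E (A \<union> B) u w m"
proof -
  obtain l where l: "\<forall>i<m. spath E A u v (l + 2 * i)" using assms unfolding prog_paths_def by auto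
  have "spath E (A \<union> B) u w ((l + k) + 2 * i)" if "i < m" for i
    using spath_append[of E A u v "l + 2 * i" B w k] l assms that by (simp add: algebra_simps)
  then show ?thesis unfolding prog_paths_def by blast
qed

text \<open>Sums of two progressions of difference 2 with \<open>p\<close> and \<open>r\<close>
  terms form a progression with \<open>p + r - 1\<close> terms.\<close>

lemma prog_paths_join:
  assumes A: "prog_paths E A u v p" and e: "E v v'" and B: "prog_paths E B v' w r"
    and disj: "A \<inter> B = {}" and "1 \<le> p" "1 \<le> r" "m + 1 \<le> p + r"
  shows "prog_paths E (A \<union> B) u w m"
proof -
  obtain a where a: "\<forall>i<p. spath E A u v (a + 2 * i)" using A unfolding prog_paths_def by auto
  obtain b where b: "\<forall>i<r. spath E B v' w (b + 2 * i)" using B unfolding prog_paths_def by auto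
  have "spath E (A \<union> B) u w (Suc (a + b) + 2 * i)" if "i < m" for i
  proof -
    \<comment> \<open>The first family contributes as many of the \<open>i\<close> increments as it
      can, the second one the remaining \<open>i - j\<close>.\<close>
    define j where "j = min i (p - 1)"
    have j: "j < p" "i - j < r" "j \<le> i" using assms that unfolding j_def by auto
    then have "spath E (A \<union> B) u w (Suc ((a + 2 * j) + (b + 2 * (i - j))))"
      using a b e disj by (intro spath_join) auto
    moreover have "Suc ((a + 2 * j) + (b + 2 * (i - j))) = Suc (a + b) + 2 * i" using j by simp
    ultimately show ?thesis by metis
  qed
  then show ?thesis unfolding prog_paths_def by blast
qed

lemma prog_paths_single: "spath E A u v n \<Longrightarrow> prog_paths E A u v 1"
  unfolding prog_paths_def by auto

section \<open>Path lengths in complete bipartite graphs\<close>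

text \<open>A detour \<open>x\<close>, \<open>b\<close>, \<open>x'\<close> adds 2 and uses up one
  vertex of each class; the recursion continues without \<open>x\<close> and \<open>b\<close> and
  keeps \<open>a\<close> for the end.\<close>

lemma biclique_path_across:
  assumes "finite X" "finite Y" "X \<inter> Y = {}" "symp E" "\<forall>a\<in>X. \<forall>b\<in>Y. E a b"
    and "x \<in> X" "a \<in> Y" "j < card X" "j < card Y"
  shows "spath E (X \<union> Y) x a (2 * j + 1)"
  using assms
proof (induction j arbitrary: X Y x)
  case 0
  then have "spath E {x, a} x a 1" by (intro spath_edge) auto
  then show ?case using 0 by (auto intro: spath_mono)
next
  case (Suc j)
  have "card (Y - {a}) \<noteq> 0" "card (X - {x}) \<noteq> 0" using Suc by auto
  then obtain b x' where b: "b \<in> Y" "b \<noteq> a" and x': "x' \<in> X" "x' \<noteq> x"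
    by (metis DiffE card.empty ex_in_conv insertCI)
  have "spath E ((X - {x}) \<union> (Y - {b})) x' a (2 * j + 1)"
    using Suc.prems b x' by (intro Suc.IH) auto
  moreover have "spath E {x, b} x b 1" using Suc.prems b by (intro spath_edge) auto
  moreover have "E b x'" using Suc.prems b x' by (auto dest: sympD)
  ultimately have "spath E ({x, b} \<union> ((X - {x}) \<union> (Y - {b}))) x a (Suc (1 + (2 * j + 1)))"
    using Suc.prems b x' by (intro spath_join[of E _ x b]) auto
  then show ?case using Suc.prems b by (auto elim: spath_mono)
qed

lemma biclique_prog_across:
  assumes "finite X" "finite Y" "X \<inter> Y = {}" "symp E" "\<forall>a\<in>X. \<forall>b\<in>Y. E a b"
    and "x \<in> X" "a \<in> Y" "card X \<le> card Y"
  shows "prog_paths E (X \<union> Y) x a (card X)"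
  unfolding prog_paths_def using biclique_path_across[OF assms(1-7)] assms(8)
  by (intro exI[of _ 1]) (auto simp: add.commute)

text \<open>A path across that avoids \<open>w\<close> is followed by an edge to \<open>w\<close>.
  Reserving \<open>w\<close> costs one of the \<open>card X\<close> lengths.\<close>

lemma biclique_prog_within:
  assumes "finite X" "finite Y" "X \<inter> Y = {}" "symp E" "\<forall>a\<in>X. \<forall>b\<in>Y. E a b"
    and "x \<in> X" "w \<in> X" "w \<noteq> x" "card X \<le> card Y"
  shows "prog_paths E (X \<union> Y) x w (card X - 1)"
proof -
  have "Y \<noteq> {}" using assms by (metis card.empty card_0_eq empty_iff le_zero_eq)
  then obtain a where a: "a \<in> Y" by auto
  have "spath E (X \<union> Y) x w (2 + 2 * j)" if j: "j < card X - 1" for j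
  proof -
    have "spath E ((X - {w}) \<union> Y) x a (2 * j + 1)"
      using assms j a by (intro biclique_path_across) auto
    moreover have "E a w" using assms a by (auto dest: sympD)
    moreover have "spath E {w} w w 0" by (auto intro: spath_refl)
    ultimately have "spath E (((X - {w}) \<union> Y) \<union> {w}) x w (Suc (2 * j + 1 + 0))"
      using assms by (intro spath_join[where v = a]) auto
    then show ?thesis using assms by (auto elim: spath_mono)
  qed
  then show ?thesis unfolding prog_paths_def by blast
qed

section \<open>Rooted graphs\<close>

definition nbrs :: "'a set \<Rightarrow> ('a \<Rightarrow> 'a \<Rightarrow> bool) \<Rightarrow> 'a \<Rightarrow> 'a set" where
  "nbrs V E v = {u \<in> V. E v u}"

text \<open>For nonadjacent \<open>x\<close> and \<open>y\<close> this says that adding the edge \<open>xy\<close> makes the graph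
  2-connected.\<close>

definition rooted :: "'a set \<Rightarrow> ('a \<Rightarrow> 'a \<Rightarrow> bool) \<Rightarrow> 'a \<Rightarrow> 'a \<Rightarrow> bool" where
  "rooted V E x y \<longleftrightarrow>
     (\<forall>S q. S \<subseteq> V - {x, y} \<longrightarrow> S \<noteq> {} \<longrightarrow> (\<exists>u\<in>S. \<exists>t\<in>V - S. t \<noteq> q \<and> E u t))"

text \<open>The alternative \<open>m \<le> 1\<close> admits contracted graphs whose degree budget is
  used up: connectivity alone still yields one path there, which is why path numbers of the form
  \<open>max 1 _\<close> appear below.\<close>

definition rooted_graph :: "'a set \<Rightarrow> ('a \<Rightarrow> 'a \<Rightarrow> bool) \<Rightarrow> 'a \<Rightarrow> 'a \<Rightarrow> nat \<Rightarrow> bool" where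
  "rooted_graph V E x y m \<longleftrightarrow>
     finite V \<and> x \<in> V \<and> y \<in> V \<and> x \<noteq> y \<and> symp E \<and> irreflp E \<and> \<not> E x y \<and> V \<noteq> {x, y} \<and>
     rooted V E x y \<and> (m \<le> 1 \<or> (\<forall>v\<in>V - {x, y}. 2 * m \<le> card (nbrs V E v)))"

text \<open>All paths of the family enter \<open>y\<close> through the same neighbour \<open>g\<close>. This makes the family
  survive the expansion of a contracted set at \<open>y\<close>, which shifts the lengths by an amount depending
  on \<open>g\<close>.\<close>

definition shared_paths :: "'a set \<Rightarrow> ('a \<Rightarrow> 'a \<Rightarrow> bool) \<Rightarrow> 'a \<Rightarrow> 'a \<Rightarrow> nat \<Rightarrow> bool" where
  "shared_paths V E x y m \<longleftrightarrow> (\<exists>g\<in>V - {y}. E g y \<and> prog_paths E (V - {y}) x g m)"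

lemma rootedD:
  assumes "rooted V E x y" "S \<subseteq> V - {x, y}" "S \<noteq> {}"
  obtains u t where "u \<in> S" "t \<in> V" "t \<notin> S" "t \<noteq> q" "E u t"
  using assms unfolding rooted_def by blast

lemma rooted_sym: "rooted V E x y \<Longrightarrow> rooted V E y x"
  unfolding rooted_def by (simp add: insert_commute)

lemma rooted_graph_sym: "rooted_graph V E x y m \<Longrightarrow> rooted_graph V E y x m"
  unfolding rooted_graph_def by (auto simp: insert_commute rooted_sym dest: sympD)

text \<open>The vertices not reachable from \<open>x\<close> without \<open>y\<close> would have no
  exit other than \<open>y\<close>, which \<open>rooted\<close> excludes with
  \<open>q = y\<close>.\<close>

lemma rooted_joined:
  assumes "rooted V E x y" "symp E" "x \<in> V" "x \<noteq> y" "v \<in> V" "v \<noteq> y"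
  shows "joined E (V - {y}) x v"
proof (rule ccontr)
  assume neg: "\<not> joined E (V - {y}) x v"
  define S where "S = {v \<in> V - {y}. \<not> joined E (V - {y}) x v}"
  have x: "joined E (V - {y}) x x" using assms by (auto intro: joined_refl)
  then have "S \<subseteq> V - {x, y}" "S \<noteq> {}" using assms neg unfolding S_def by auto
  then obtain u t where "u \<in> S" "t \<in> V" "t \<notin> S" "t \<noteq> y" "E u t"
    using rootedD[OF assms(1), of S y] by metis
  then show False using assms(2) unfolding S_def by (auto intro: joined_extend dest: sympD)
qed

lemma rooted_nbr:
  assumes "rooted V E x y" "V \<noteq> {x, y}" "x \<in> V" "y \<in> V"
  obtains g where "g \<in> V" "g \<noteq> x" "g \<noteq> y" "E g y"
proof -
  have "V - {x, y} \<noteq> {}" using assms by auto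
  then obtain u t where "u \<in> V - {x, y}" "t \<in> V" "t \<notin> V - {x, y}" "t \<noteq> x" "E u t"
    using rootedD[OF assms(1), of "V - {x, y}" x] by auto
  then show ?thesis using that by auto
qed

lemma shared_paths_one:
  assumes "rooted_graph V E x y m" "m \<le> 1"
  shows "shared_paths V E x y m"
proof -
  have G: "rooted V E x y" "V \<noteq> {x, y}" "x \<in> V" "y \<in> V" "symp E" "x \<noteq> y"
    using assms unfolding rooted_graph_def by auto
  obtain g where g: "g \<in> V" "g \<noteq> x" "g \<noteq> y" "E g y" using rooted_nbr[OF G(1-4)] .
  then obtain n where "spath E (V - {y}) x g n"
    using rooted_joined[OF G(1,5,3,6)] unfolding joined_def by metis
  then have "prog_paths E (V - {y}) x g m"
    by (intro prog_paths_mono[OF prog_paths_single]) (use assms(2) in auto)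
  then show ?thesis using g unfolding shared_paths_def by auto
qed

text \<open>All members of the family continue along one fixed path from \<open>c\<close>, so the
  last edge is common even if they enter \<open>c\<close> differently.\<close>

lemma shared_paths_tail:
  assumes "symp E" "prog_paths E A x c m" "spath E B c y n" "A \<inter> B \<subseteq> {c}" "c \<noteq> y"
    "A \<union> B \<subseteq> V" "y \<notin> A"
  shows "shared_paths V E x y m"
proof -
  obtain g k where g: "spath E (B - {y}) c g k" "E g y"
    using spath_split_last[OF assms(1,3,5)] .
  have "prog_paths E (A \<union> (B - {y})) x g m"
    using assms g by (intro prog_paths_append[of E A x c]) auto
  then have "prog_paths E (V - {y}) x g m" by (rule prog_paths_mono) (use assms in auto)
  moreover have "g \<in> B - {y}" using g spath_endpoints by metis
  ultimately show ?thesis using assms g unfolding shared_paths_def by auto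
qed

section \<open>Contracting a set to a root\<close>

text \<open>The vertex \<open>x\<close>, which lies outside \<open>P\<close> and differs from \<open>c\<close>, stands for the contracted
  set \<open>T\<close>.\<close>

definition contr :: "('a \<Rightarrow> 'a \<Rightarrow> bool) \<Rightarrow> 'a set \<Rightarrow> 'a \<Rightarrow> 'a \<Rightarrow> 'a set \<Rightarrow> 'a \<Rightarrow> 'a \<Rightarrow> bool" where
  "contr E P c x T u v \<longleftrightarrow>
     u \<in> insert c P \<and> v \<in> insert c P \<and> E u v \<or>
     u = x \<and> v \<in> P \<and> (\<exists>w\<in>T. E v w) \<or> v = x \<and> u \<in> P \<and> (\<exists>w\<in>T. E u w)"

text \<open>\<open>P\<close> itself has exits both to \<open>c\<close> and to the contracted vertex,
  so no single \<open>q\<close> blocks it; proper subsets are left to \<open>inner\<close>. All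
  edges from a vertex into \<open>T\<close> merge into one, hence the summand 1 in
  \<open>deg\<close>.\<close>

lemma contr_rooted_graph:
  assumes E: "symp E" "irreflp E" and P: "finite P" "P \<noteq> {}" "x \<notin> insert c P" "c \<notin> P"
    and exits: "\<exists>p\<in>P. \<exists>w\<in>T. E p w" and c: "\<exists>p\<in>P. E p c"
    and inner: "\<And>S q. S \<subset> P \<Longrightarrow> S \<noteq> {} \<Longrightarrow> \<exists>u\<in>S. \<exists>t\<in>insert c P - S. t \<noteq> q \<and> E u t"
    and deg: "r \<le> 1 \<or> (\<forall>v\<in>P. 2 * r \<le> card (nbrs (insert c P) E v) + (if \<exists>w\<in>T. E v w then 1 else 0))"
  shows "rooted_graph (insert x (insert c P)) (contr E P c x T) c x r"
proof -
  let ?C = "contr E P c x T" and ?V = "insert x (insert c P)"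
  have V: "?V - {c, x} = P" using P by auto
  have "symp ?C" using E unfolding contr_def by (auto intro!: sympI dest: sympD)
  moreover have "irreflp ?C" using E P unfolding contr_def by (auto intro!: irreflpI dest: irreflpD)
  moreover have "rooted ?V ?C c x"
    unfolding rooted_def V
  proof (intro allI impI)
    fix S q assume S: "S \<subseteq> P" "S \<noteq> {}"
    show "\<exists>u\<in>S. \<exists>t\<in>?V - S. t \<noteq> q \<and> ?C u t"
    proof (cases "S = P")
      case True
      show ?thesis
      proof (cases "q = c")
        case True
        obtain p where "p \<in> P" "?C p x" using exits unfolding contr_def by auto
        then show ?thesis using P \<open>S = P\<close> True by (intro bexI[of _ p] bexI[of _ x]) auto
      next
        case False
        obtain p where "p \<in> P" "?C p c" using c unfolding contr_def by auto
        then show ?thesis using P \<open>S = P\<close> False by (intro bexI[of _ p] bexI[of _ c]) auto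
      qed
    next
      case False
      then obtain u t where "u \<in> S" "t \<in> insert c P - S" "t \<noteq> q" "E u t"
        using inner[of S q] S by blast
      then show ?thesis using S unfolding contr_def by blast
    qed
  qed
  moreover have "r \<le> 1 \<or> (\<forall>v\<in>P. 2 * r \<le> card (nbrs ?V ?C v))"
  proof (cases "r \<le> 1")
    case False
    have "card (nbrs ?V ?C v) = card (nbrs (insert c P) E v) + (if \<exists>w\<in>T. E v w then 1 else 0)"
      if v: "v \<in> P" for v
    proof -
      have "nbrs ?V ?C v = nbrs (insert c P) E v \<union> (if \<exists>w\<in>T. E v w then {x} else {})"
        using v P unfolding nbrs_def contr_def by auto
      moreover have "x \<notin> nbrs (insert c P) E v" "finite (nbrs (insert c P) E v)"
        using P unfolding nbrs_def by auto
      ultimately show ?thesis by auto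
    qed
    then show ?thesis using deg False by auto
  qed simp
  moreover have "\<not> ?C c x" using P unfolding contr_def by auto
  ultimately show ?thesis using P unfolding rooted_graph_def V by auto
qed

section \<open>Vertex sets attached to a biclique\<close>

text \<open>\<open>smaller\<close> is the induction hypothesis of the path theorem; it stays in one
  vertex type, so contraction reuses \<open>x\<close> as its new vertex. \<open>Y\<close> may be a
  proper part of the common neighbourhood of \<open>X\<close>, since some of its vertices are later
  set aside as ways out.\<close>

locale biclique_core =
  fixes V :: "'a set" and E :: "'a \<Rightarrow> 'a \<Rightarrow> bool" and x :: 'a and X Y :: "'a set" and m :: nat
  assumes finV: "finite V" and symE: "symp E" and irrE: "irreflp E"
    and XV: "X \<subseteq> V" and YV: "Y \<subseteq> V" and XY: "X \<inter> Y = {}" and xX: "x \<in> X"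
    and cardXY: "card X \<le> card Y" and complete: "\<forall>a\<in>X. \<forall>b\<in>Y. E a b"
    and smaller: "\<And>(V' :: 'a set) E' x' y' m'. card V' < card V \<Longrightarrow> rooted_graph V' E' x' y' m' \<Longrightarrow>
      shared_paths V' E' x' y' m'"
begin

text \<open>\<open>c\<close> is the only exit of \<open>P\<close> besides the biclique. The bounds
  on neighbours are those supplied by maximality of the biclique. The last two clauses say that no
  single vertex of \<open>V\<close> is the only exit of a part of \<open>P\<close>, and that every
  vertex of \<open>P\<close> reaches \<open>c\<close> inside \<open>insert c P\<close>.\<close>

definition attached :: "'a set \<Rightarrow> 'a \<Rightarrow> bool" where
  "attached P c \<longleftrightarrow> P \<subseteq> V \<and> P \<noteq> {} \<and> c \<in> V \<and> P \<inter> (X \<union> Y) = {} \<and> c \<notin> P \<union> X \<union> Y \<and>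
     (\<forall>p\<in>P. nbrs V E p \<subseteq> insert c P \<union> X \<union> Y \<and> card (nbrs V E p \<inter> X) < card X \<and>
       card (nbrs V E p \<inter> Y) \<le> card X \<and> 2 * m \<le> card (nbrs V E p)) \<and>
     (\<forall>S q. S \<subseteq> P \<longrightarrow> S \<noteq> {} \<longrightarrow> (\<exists>u\<in>S. \<exists>t\<in>V - S. t \<noteq> q \<and> E u t)) \<and>
     (\<forall>S. S \<subseteq> P \<longrightarrow> S \<noteq> {} \<longrightarrow> (\<exists>u\<in>S. \<exists>t\<in>insert c P - S. E u t))"

lemma finX: "finite X" and finY: "finite Y"
  using XV YV finV finite_subset by auto

lemma card_X: "1 \<le> card X"
  using xX finX by (cases "card X") auto

lemma attachedD:
  assumes "attached P c"
  shows "P \<subseteq> V" "P \<noteq> {}" "c \<in> V" "P \<inter> X = {}" "P \<inter> Y = {}" "c \<notin> P" "c \<notin> X" "c \<notin> Y" "finite P"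
    "x \<notin> insert c P"
    "\<And>p t. p \<in> P \<Longrightarrow> t \<in> V \<Longrightarrow> E p t \<Longrightarrow> t \<in> insert c P \<union> X \<union> Y"
    "\<And>p. p \<in> P \<Longrightarrow> card (nbrs V E p \<inter> X) < card X"
    "\<And>p. p \<in> P \<Longrightarrow> card (nbrs V E p \<inter> Y) \<le> card X"
    "\<And>p. p \<in> P \<Longrightarrow> 2 * m \<le> card (nbrs V E p)"
    "\<And>S q. S \<subseteq> P \<Longrightarrow> S \<noteq> {} \<Longrightarrow> \<exists>u\<in>S. \<exists>t\<in>V - S. t \<noteq> q \<and> E u t"
    "\<And>S. S \<subseteq> P \<Longrightarrow> S \<noteq> {} \<Longrightarrow> \<exists>u\<in>S. \<exists>t\<in>insert c P - S. E u t"
  using assms finite_subset[OF _ finV, of P] xX unfolding attached_def nbrs_def by auto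

lemma attached_degree:
  assumes "attached P c" "p \<in> P"
  shows "2 * m \<le> card (nbrs (insert c P) E p) + card (nbrs V E p \<inter> X) + card (nbrs V E p \<inter> Y)"
proof -
  note D = attachedD[OF assms(1)]
  have "nbrs V E p = nbrs (insert c P) E p \<union> (nbrs V E p \<inter> X) \<union> (nbrs V E p \<inter> Y)"
    using D(1,3) D(11)[OF assms(2)] unfolding nbrs_def by auto
  then have "card (nbrs V E p) \<le>
      card (nbrs (insert c P) E p) + card (nbrs V E p \<inter> X) + card (nbrs V E p \<inter> Y)"
    by (metis (no_types, lifting) add_le_mono1 card_Un_le dual_order.trans)
  then show ?thesis using D(14)[OF assms(2)] by linarith
qed

text \<open>A vertex of \<open>Y\<close> is lost in the contraction, and \<open>Y\<close> is
  nonempty since it is at least as large as \<open>X\<close>.\<close>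

lemma attached_size:
  assumes "attached P c"
  shows "card (insert x (insert c P)) < card V"
proof -
  note D = attachedD[OF assms]
  have "card Y \<noteq> 0" using cardXY xX finX by (metis card_0_eq empty_iff le_zero_eq)
  then obtain b where b: "b \<in> Y" by fastforce
  have "insert x (insert c P) \<subseteq> V" using D(1,3) XV xX by auto
  moreover have "b \<in> V" "b \<notin> insert x (insert c P)" using b D(5,8) YV xX XY by auto
  ultimately have "insert x (insert c P) \<subset> V" by auto
  then show ?thesis using finV psubset_card_mono by blast
qed

text \<open>\<open>S\<close> together with the component of \<open>q\<close> outside
  \<open>S\<close> has no exit inside \<open>insert c P\<close>, so it cannot be contained in
  \<open>P\<close>.\<close>

lemma attached_tail:
  assumes "attached P c" "S \<subseteq> P" "S \<noteq> {}" "\<forall>u\<in>S. \<forall>t\<in>insert c P - S. E u t \<longrightarrow> t = q"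
  shows "q \<in> insert c P - S" "joined E (insert c P - S) q c"
proof -
  note D = attachedD[OF assms(1)]
  show q: "q \<in> insert c P - S" using D(16)[OF assms(2,3)] assms(4) by blast
  define C where "C = {v \<in> insert c P - S. joined E (insert c P - S) q v}"
  have qC: "q \<in> C" using q unfolding C_def by (auto intro: joined_refl)
  show "joined E (insert c P - S) q c"
  proof (rule ccontr)
    assume "\<not> ?thesis"
    then have "S \<union> C \<subseteq> P" using assms unfolding C_def by auto
    then obtain u t where u: "u \<in> S \<union> C" and t: "t \<in> insert c P - (S \<union> C)" "E u t"
      using D(16)[of "S \<union> C"] assms(3) by auto
    show False
    proof (cases "u \<in> S")
      case True then show False using assms(4)[rule_format, of u t] t qC by auto
    next
      case False
      then have "t \<in> C" using u t unfolding C_def by (auto intro: joined_extend)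
      then show False using t by auto
    qed
  qed
qed

text \<open>Every exit of \<open>S\<close> inside \<open>insert c P\<close> is \<open>q\<close>, so
  \<open>q\<close> takes over the role of \<open>c\<close>; the other clauses pass to
  subsets.\<close>

lemma attached_subset:
  assumes "attached P c" "S \<subseteq> P" "S \<noteq> {}" "\<forall>u\<in>S. \<forall>t\<in>insert c P - S. E u t \<longrightarrow> t = q"
  shows "attached S q"
proof -
  note D = attachedD[OF assms(1)]
  have q: "q \<in> insert c P - S" by (rule attached_tail(1)[OF assms])
  have "t \<in> insert q S" if "u \<in> S" "t \<in> insert c P" "E u t" for u t
    using that assms(4)[rule_format, of u t] by auto
  then have 1: "nbrs V E p \<subseteq> insert q S \<union> X \<union> Y" if "p \<in> S" for p
    using that D(11)[of p] assms(2) unfolding nbrs_def by blast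
  have 2: "\<exists>u\<in>S'. \<exists>t\<in>insert q S - S'. E u t" if S': "S' \<subseteq> S" "S' \<noteq> {}" for S'
  proof -
    obtain u t where "u \<in> S'" "t \<in> insert c P - S'" "E u t" using D(16)[of S'] S' assms(2) by blast
    then show ?thesis using assms(4)[rule_format, of u t] S' by (cases "t \<in> S") auto
  qed
  have 3: "P \<inter> (X \<union> Y) = {}" using D(4,5) by blast
  show ?thesis
    unfolding attached_def
  proof (intro conjI ballI allI impI)
    show "S \<inter> (X \<union> Y) = {}" "q \<notin> S \<union> X \<union> Y" "S \<subseteq> V" "q \<in> V" using 3 q D(1,3,7,8) assms(2) by auto
  next
    fix S' q' assume "S' \<subseteq> S" "S' \<noteq> {}"
    then show "\<exists>u\<in>S'. \<exists>t\<in>V - S'. t \<noteq> q' \<and> E u t" using D(15)[of S' q'] assms(2) by blast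
  qed (use 1 2 D(12-14) assms in auto)
qed

text \<open>The induction hypothesis is applied with both orders of the roots. From \<open>c\<close>
  to \<open>x\<close> the shared edge is at the contracted vertex and lifts to a single vertex
  \<open>w\<close> of \<open>T\<close>; from \<open>x\<close> to \<open>c\<close> the shared edge is
  at \<open>c\<close>.\<close>

lemma attached_contract:
  assumes att: "attached P c"
    and inner: "\<And>S q. S \<subset> P \<Longrightarrow> S \<noteq> {} \<Longrightarrow> \<exists>u\<in>S. \<exists>t\<in>insert c P - S. t \<noteq> q \<and> E u t"
    and exits: "\<exists>p\<in>P. \<exists>w\<in>T. E p w"
    and deg: "r \<le> 1 \<or> (\<forall>v\<in>P. 2 * r \<le> card (nbrs (insert c P) E v) + (if \<exists>w\<in>T. E v w then 1 else 0))"
  shows "\<exists>g\<in>P. \<exists>w\<in>T. E w g \<and> prog_paths E (insert c P) g c r"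
    and "shared_paths (insert x (insert c P)) (contr E P c x T) x c r"
proof -
  note D = attachedD[OF att]
  let ?C = "contr E P c x T" and ?V = "insert x (insert c P)"
  have "\<exists>p\<in>P. E p c" using D(16)[of P] D(2,6) by auto
  then have G: "rooted_graph ?V ?C c x r"
    using contr_rooted_graph[OF symE irrE D(9,2,10,6) exits _ inner deg] by blast
  show "shared_paths ?V ?C x c r"
    using smaller[OF attached_size[OF att] rooted_graph_sym[OF G]] .
  obtain g where g: "?C g x" "prog_paths ?C (?V - {x}) c g r"
    using smaller[OF attached_size[OF att] G] unfolding shared_paths_def by auto
  have eq: "?V - {x} = insert c P" using D by auto
  have sym: "E a b" if "?C a b" "a \<in> insert c P" "b \<in> insert c P" for a b
    using that D(10) unfolding contr_def by auto
  have "prog_paths E (insert c P) g c r"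
    using g(2) spath_mono_rel[of ?C "insert c P" c g _ E] sym spath_rev[OF symE]
    unfolding prog_paths_def eq by blast
  moreover have "g \<in> P" "\<exists>w\<in>T. E w g" using g(1) D(10) symE unfolding contr_def by (auto dest: sympD)
  ultimately show "\<exists>g\<in>P. \<exists>w\<in>T. E w g \<and> prog_paths E (insert c P) g c r" by blast
qed

text \<open>Put \<open>s = card X\<close>. A vertex with neighbours in \<open>Y\<close> loses at
  most \<open>(s - 1) + s\<close> of them and regains one, which is \<open>2 * (s - 1)\<close> in
  total; a vertex without neighbours in \<open>Y\<close> loses at most \<open>s - 1\<close>.\<close>

lemma attached_degree_Y:
  assumes att: "attached P c"
  shows "max 1 (m + 1 - card X) \<le> 1 \<or> (\<forall>v\<in>P. 2 * max 1 (m + 1 - card X) \<le>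
      card (nbrs (insert c P) E v) + (if \<exists>w\<in>Y. E v w then 1 else 0))"
proof (cases "m + 1 - card X \<le> 1")
  case False
  have "2 * (m + 1 - card X) \<le> card (nbrs (insert c P) E v) + (if \<exists>w\<in>Y. E v w then 1 else 0)"
    if v: "v \<in> P" for v
  proof -
    have "nbrs V E v \<inter> Y = {}" if "\<not> (\<exists>w\<in>Y. E v w)" using that unfolding nbrs_def by auto
    then show ?thesis
      using attached_degree[OF att v] attachedD(12,13)[OF att v] False by (auto split: if_splits)
  qed
  then show ?thesis using False by (auto simp: max_def)
qed auto

text \<open>If a part of \<open>P\<close> is separated from the rest of \<open>P\<close> and \<open>c\<close> by a single vertex, that part
  replaces \<open>P\<close>. Otherwise \<open>Y\<close>, \<open>X\<close> or \<open>X - {x}\<close> is contracted to \<open>x\<close>, and the induction hypothesis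
  is applied from \<open>c\<close> to \<open>x\<close>: sharing the last edge means that all paths reach the same vertex of
  the biclique.\<close>

lemma attached_prog:
  assumes "attached P c"
  shows "prog_paths E (X \<union> Y \<union> insert c P) x c m"
  using assms
proof (induction "card P" arbitrary: P c rule: less_induct)
  case less
  note att = less.prems and D = attachedD[OF less.prems]
  show ?case
  proof (cases "\<exists>S q. S \<subset> P \<and> S \<noteq> {} \<and> (\<forall>u\<in>S. \<forall>t\<in>insert c P - S. E u t \<longrightarrow> t = q)")
    case True
    then obtain S q where S: "S \<subset> P" "S \<noteq> {}"
      "\<forall>u\<in>S. \<forall>t\<in>insert c P - S. E u t \<longrightarrow> t = q" by auto
    then have SP: "S \<subseteq> P" by auto
    have "card S < card P" using S D(9) psubset_card_mono by blast
    then have 1: "prog_paths E (X \<union> Y \<union> insert q S) x q m"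
      using less.hyps attached_subset[OF att SP S(2,3)] by blast
    obtain n where 2: "spath E (insert c P - S) q c n"
      using attached_tail(2)[OF att SP S(2,3)] unfolding joined_def by auto
    have "(X \<union> Y \<union> insert q S) \<inter> (insert c P - S) \<subseteq> {q}" using D(4,5,7,8) by blast
    from prog_paths_append[OF 1 2 this] show ?thesis
      by (rule prog_paths_mono) (use SP attached_tail(1)[OF att SP S(2,3)] in auto)
  next
    case False
    then have inner: "\<exists>u\<in>S. \<exists>t\<in>insert c P - S. t \<noteq> q \<and> E u t" if "S \<subset> P" "S \<noteq> {}" for S q
      using that by blast
    have disj: "(X \<union> Y) \<inter> insert c P = {}" using D(4,5,7,8) by blast
    \<comment> \<open>In each case below \<open>p\<close> lengths come from the biclique and
      \<open>r\<close> from \<open>P\<close>. After contracting \<open>Y\<close> these are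
      \<open>card X\<close> and \<open>m + 1 - card X\<close>, whose sum is exactly large
      enough.\<close>
    have fin: "prog_paths E (X \<union> Y \<union> insert c P) x c m"
      if "g \<in> P" "E w g" "prog_paths E (insert c P) g c r" "prog_paths E (X \<union> Y) x w p"
        "1 \<le> p" "1 \<le> r" "m + 1 \<le> p + r" for g w r p
      using prog_paths_join[OF that(4) that(2,3) disj that(5-7)] .
    have nX: "nbrs V E p \<inter> X \<noteq> {} \<longleftrightarrow> (\<exists>w\<in>X. E p w)" for p using XV unfolding nbrs_def by auto
    have finN: "finite (nbrs V E p \<inter> X)" for p using finX by auto
    consider (Y) "\<exists>p\<in>P. \<exists>w\<in>Y. E p w"
      | (X1) "\<not> (\<exists>p\<in>P. \<exists>w\<in>Y. E p w)" "card X \<le> 2 \<or> \<not> (\<exists>p\<in>P. \<exists>w\<in>X - {x}. E p w)"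
      | (X2) "\<not> (\<exists>p\<in>P. \<exists>w\<in>Y. E p w)" "3 \<le> card X" "\<exists>p\<in>P. \<exists>w\<in>X - {x}. E p w"
      by linarith
    then show ?thesis
    proof cases
      case Y
      obtain g w where "g \<in> P" "w \<in> Y" "E w g"
        "prog_paths E (insert c P) g c (max 1 (m + 1 - card X))"
        using attached_contract(1)[OF att inner Y attached_degree_Y[OF att]] by blast
      moreover have "prog_paths E (X \<union> Y) x w (card X)"
        using biclique_prog_across[OF finX finY XY symE complete xX \<open>w \<in> Y\<close> cardXY] .
      ultimately show ?thesis using card_X fin[of g w "max 1 (m + 1 - card X)" "card X"] by auto
    next
      case X1
      have noY: "nbrs V E p \<inter> Y = {}" if "p \<in> P" for p using X1(1) that unfolding nbrs_def by auto
      \<comment> \<open>With one neighbour in \<open>X\<close> and none in \<open>Y\<close>,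
        contracting \<open>X\<close> costs no degree, so a single path in the biclique
        suffices.\<close>
      have le1: "card (nbrs V E p \<inter> X) \<le> 1" if p: "p \<in> P" for p
      proof (cases "card X \<le> 2")
        case False
        then have "nbrs V E p \<inter> X \<subseteq> {x}" using X1(2) p unfolding nbrs_def by auto
        then show ?thesis using card_mono[of "{x}"] by auto
      qed (use D(12)[OF p] in auto)
      \<comment> \<open>\<open>c\<close> cannot be the only exit of \<open>P\<close>, and no exit
        lies in \<open>Y\<close>.\<close>
      have exits: "\<exists>p\<in>P. \<exists>w\<in>X. E p w"
        using D(15)[of P c] D(2) D(11) X1(1) by blast
      have "2 * m \<le> card (nbrs (insert c P) E v) + (if \<exists>w\<in>X. E v w then 1 else 0)" if v: "v \<in> P" for v
        using attached_degree[OF att v] noY[OF v] le1[OF v] nX[of v] by (cases "\<exists>w\<in>X. E v w") auto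
      then obtain g w where gw: "g \<in> P" "w \<in> X" "E w g" "prog_paths E (insert c P) g c m"
        using attached_contract(1)[OF att inner exits, of m] by blast
      have "prog_paths E (X \<union> Y) x w 1"
      proof (cases "w = x")
        case True
        then show ?thesis using xX prog_paths_single[OF spath_refl[of x "X \<union> Y" E]] by simp
      next
        case False
        then have "card {x, w} \<le> card X" using gw xX finX by (intro card_mono) auto
        then have "1 \<le> card X - 1" using False by auto
        then show ?thesis
          using prog_paths_mono[OF biclique_prog_within[OF finX finY XY symE complete xX gw(2) False cardXY]]
          by blast
      qed
      then have "1 \<le> m \<Longrightarrow> ?thesis" using fin[OF gw(1,3,4)] by simp
      then show ?thesis by (cases "m = 0") (auto simp: prog_paths_def)
    next
      case X2
      have noY: "nbrs V E p \<inter> Y = {}" if "p \<in> P" for p using X2(1) that unfolding nbrs_def by auto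
      \<comment> \<open>Leaving \<open>x\<close> out of the contracted set ensures
        \<open>w \<noteq> x\<close>, so the biclique supplies \<open>card X - 1\<close> lengths;
        hence \<open>m + 2\<close> instead of \<open>m + 1\<close>.\<close>
      let ?r = "max 1 (m + 2 - card X)"
      have "2 * (m + 2 - card X) \<le> card (nbrs (insert c P) E v) + (if \<exists>w\<in>X - {x}. E v w then 1 else 0)"
        if v: "v \<in> P" and r: "m + 2 - card X > 1" for v
      proof (cases "\<exists>w\<in>X - {x}. E v w")
        case True
        then show ?thesis
          using attached_degree[OF att v] noY[OF v] D(12)[OF v] X2(2) r by auto
      next
        case False
        \<comment> \<open>Only the edge to \<open>x\<close> can be lost, and
          \<open>3 \<le> card X\<close> makes \<open>2 * m - 1\<close> large enough.\<close>
        then have "nbrs V E v \<inter> X \<subseteq> {x}" unfolding nbrs_def by auto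
        then have "card (nbrs V E v \<inter> X) \<le> 1" using card_mono[of "{x}"] by auto
        then show ?thesis using attached_degree[OF att v] noY[OF v] X2(2) r by auto
      qed
      then have "?r \<le> 1 \<or> (\<forall>v\<in>P. 2 * ?r \<le>
          card (nbrs (insert c P) E v) + (if \<exists>w\<in>X - {x}. E v w then 1 else 0))"
        by (cases "m + 2 - card X \<le> 1") (auto simp: max_def)
      then obtain g w where gw: "g \<in> P" "w \<in> X" "w \<noteq> x" "E w g" "prog_paths E (insert c P) g c ?r"
        using attached_contract(1)[OF att inner X2(3)] by blast
      show ?thesis
        using fin[OF gw(1,4,5) biclique_prog_within[OF finX finY XY symE complete xX gw(2,3) cardXY]]
          X2(2) by auto
    qed
  qed
qed

text \<open>The contraction of \<open>Y\<close> is now expanded at the start of the paths. Their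
  entry points in \<open>Y\<close> may differ, which does no harm because every vertex of
  \<open>Y\<close> is reached from \<open>x\<close> by the same lengths
  \<open>1, 3, \<dots>\<close>.\<close>

lemma attached_shared:
  assumes "attached P c" "\<exists>p\<in>P. \<exists>w\<in>Y. E p w"
  shows "\<exists>g\<in>P. E g c \<and> prog_paths E (X \<union> Y \<union> P) x g m"
  using assms
proof (induction "card P" arbitrary: P rule: less_induct)
  case less
  note att = less.prems(1) and D = attachedD[OF less.prems(1)]
  show ?case
  proof (cases "\<exists>S q. S \<subset> P \<and> S \<noteq> {} \<and> (\<forall>u\<in>S. \<forall>t\<in>insert c P - S. E u t \<longrightarrow> t = q)")
    case True
    then obtain S q where S: "S \<subset> P" "S \<noteq> {}"
      "\<forall>u\<in>S. \<forall>t\<in>insert c P - S. E u t \<longrightarrow> t = q" by auto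
    then have SP: "S \<subseteq> P" by auto
    have attS: "attached S q" by (rule attached_subset[OF att SP S(2,3)])
    show ?thesis
    proof (cases "q = c")
      case True
      \<comment> \<open>A cut at \<open>c\<close> itself splits \<open>P\<close> into two sets
        attached to \<open>c\<close>, and at least one of them has a neighbour in
        \<open>Y\<close>.\<close>
      have no: "\<not> E u t" if "u \<in> P - S" "t \<in> S" for u t
        using that S(3)[rule_format, of t u] True D(6) symE by (auto dest: sympD)
      have "attached (P - S) c"
        by (rule attached_subset[OF att]) (use S no in \<open>auto simp: True\<close>)
      then have both: "attached S c" "attached (P - S) c" using attS True by auto
      have "card S < card P" "card (P - S) < card P"
        using S D(9) by (auto intro!: psubset_card_mono)
      note hyp = less.hyps[OF this(1) both(1)] less.hyps[OF this(2) both(2)]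
      have "(\<exists>p\<in>S. \<exists>w\<in>Y. E p w) \<or> (\<exists>p\<in>P - S. \<exists>w\<in>Y. E p w)" using less.prems(2) by auto
      then have "\<exists>Q\<subseteq>P. \<exists>g\<in>Q. E g c \<and> prog_paths E (X \<union> Y \<union> Q) x g m"
        using hyp SP Diff_subset[of P S] by metis
      then obtain Q g where "Q \<subseteq> P" "g \<in> Q" "E g c" "prog_paths E (X \<union> Y \<union> Q) x g m" by auto
      then have "prog_paths E (X \<union> Y \<union> P) x g m" "g \<in> P"
        by (auto elim!: prog_paths_mono)
      with \<open>E g c\<close> show ?thesis by auto
    next
      case False
      \<comment> \<open>The family up to \<open>q\<close> is continued by a single path to
        \<open>c\<close>, so its last edge is shared.\<close>
      have 1: "prog_paths E (X \<union> Y \<union> insert q S) x q m" by (rule attached_prog[OF attS])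
      obtain n where "spath E (insert c P - S) q c n"
        using attached_tail(2)[OF att SP S(2,3)] unfolding joined_def by auto
      then obtain g k where g: "spath E (insert c P - S - {c}) q g k" "E g c"
        using spath_split_last[OF symE _ False] by metis
      have "(X \<union> Y \<union> insert q S) \<inter> (insert c P - S - {c}) \<subseteq> {q}" using D(4,5) by blast
      from prog_paths_append[OF 1 g(1) this] have "prog_paths E (X \<union> Y \<union> P) x g m"
        by (rule prog_paths_mono) (use SP attached_tail(1)[OF att SP S(2,3)] False in auto)
      moreover have "g \<in> P" using spath_endpoints(2)[OF g(1)] by auto
      ultimately show ?thesis using g by auto
    qed
  next
    case False
    then have inner: "\<exists>u\<in>S. \<exists>t\<in>insert c P - S. t \<noteq> q \<and> E u t" if "S \<subset> P" "S \<noteq> {}" for S q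
      using that by blast
    let ?r = "max 1 (m + 1 - card X)"
    let ?C = "contr E P c x Y" and ?V = "insert x (insert c P)"
    obtain g l where g: "?C g c" "g \<noteq> c" "\<And>i. i < ?r \<Longrightarrow> spath ?C (?V - {c}) x g (l + 2 * i)"
      using attached_contract(2)[OF att inner less.prems(2) attached_degree_Y[OF att]]
      unfolding shared_paths_def prog_paths_def by auto
    have gP: "g \<in> P" "E g c" using g(1,2) D(6,10) symE irrE unfolding contr_def
      by (auto dest: sympD irreflpD)
    have "spath E (X \<union> Y \<union> P) x g ((l + 1) + 2 * i)" if i: "i < m" for i
    proof -
      \<comment> \<open>The first edge of a contracted path becomes a biclique path of length
        \<open>2 * j + 1\<close> and an edge from \<open>Y\<close> to \<open>P\<close>, so the total
        length grows by \<open>2 * j + 1\<close>.\<close>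
      define j where "j = min i (card X - 1)"
      have j: "j < card X" "i - j < ?r" "j \<le> i" using i card_X unfolding j_def by auto
      from g(3)[OF j(2)] obtain v n where v: "l + 2 * (i - j) = Suc n" "?C x v"
        "spath ?C (?V - {c} - {x}) v g n"
        by (cases rule: spath_cases) (use gP D(10) in auto)
      have eq: "?V - {c} - {x} = P" using D(6,10) by auto
      have "spath E P v g n"
        using v(3) unfolding eq by (rule spath_mono_rel) (use D(10) in \<open>auto simp: contr_def\<close>)
      moreover obtain w where w: "w \<in> Y" "E w v"
        using v(2) D(10) symE unfolding contr_def by (auto dest: sympD)
      moreover have "spath E (X \<union> Y) x w (2 * j + 1)"
        using biclique_path_across[OF finX finY XY symE complete xX w(1) j(1)] j(1) cardXY by auto
      moreover have "(X \<union> Y) \<inter> P = {}" using D(4,5) by auto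
      ultimately have "spath E (X \<union> Y \<union> P) x g (Suc (2 * j + 1 + n))"
        by (intro spath_join[where v = w])
      moreover have "Suc (2 * j + 1 + n) = (l + 1) + 2 * i" using v(1) j(3) by auto
      ultimately show ?thesis by metis
    qed
    then show ?thesis using gP unfolding prog_paths_def by blast
  qed
qed


end

section \<open>The path theorem for rooted graphs\<close>

text \<open>A counterexample with the fewest vertices; \<open>2 \<le> m\<close> since
  \<open>shared_paths_one\<close> settles smaller values.\<close>

locale minimal_failure =
  fixes V :: "'a set" and E :: "'a \<Rightarrow> 'a \<Rightarrow> bool" and x y :: 'a and m :: nat
  assumes G: "rooted_graph V E x y m" and m2: "2 \<le> m"
    and smaller: "\<And>(V' :: 'a set) E' x' y' m'. card V' < card V \<Longrightarrow> rooted_graph V' E' x' y' m' \<Longrightarrow>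
      shared_paths V' E' x' y' m'"
    and failure: "\<not> shared_paths V E x y m"
begin

lemma finV: "finite V" and xV: "x \<in> V" and yV: "y \<in> V" and xy: "x \<noteq> y" and symE: "symp E"
  and irrE: "irreflp E" and nxy: "\<not> E x y" and Vxy: "V \<noteq> {x, y}" and root: "rooted V E x y"
  and degV: "\<And>v. v \<in> V \<Longrightarrow> v \<noteq> x \<Longrightarrow> v \<noteq> y \<Longrightarrow> 2 * m \<le> card (nbrs V E v)"
  using G m2 unfolding rooted_graph_def by auto

lemma E_sym: "E a b \<Longrightarrow> E b a"
  using symE by (rule sympD)

lemma E_irr: "\<not> E a a"
  using irrE by (auto dest: irreflpD)

section \<open>Maximal bicliques and the component of \<open>y\<close>\<close>

definition common :: "'a set \<Rightarrow> 'a set" where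
  "common X = {v \<in> V. \<forall>u\<in>X. E u v}"

definition core :: "'a set \<Rightarrow> bool" where
  "core X \<longleftrightarrow> x \<in> X \<and> X \<subseteq> V - {y} \<and> card X \<le> card (common X)"

text \<open>The component of \<open>y\<close> outside the biclique. For a core it contains
  \<open>y\<close>, since \<open>x\<close> is not adjacent to \<open>y\<close>.\<close>

definition side :: "'a set \<Rightarrow> 'a set" where
  "side X = {v \<in> V - (X \<union> common X). joined E (V - (X \<union> common X)) v y}"

definition best :: "'a set \<Rightarrow> bool" where
  "best X \<longleftrightarrow> core X \<and> (\<forall>X'. core X' \<longrightarrow>
     card X' \<le> card X \<and> (card X' = card X \<longrightarrow> card (side X') \<le> card (side X)))"

lemma common_V: "common X \<subseteq> V"
  unfolding common_def by auto

lemma finite_sets: "X \<subseteq> V \<Longrightarrow> finite X" "finite (common X)" "finite (side X)"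
  using finV finite_subset unfolding common_def side_def by auto

lemma common_disjoint: "X \<inter> common X = {}"
  unfolding common_def using E_irr by auto

lemma coreD:
  assumes "core X"
  shows "x \<in> X" "X \<subseteq> V" "y \<notin> X" "card X \<le> card (common X)" "finite X" "y \<notin> common X" "x \<notin> common X"
    "y \<in> side X"
  using assms finite_sets nxy E_irr yV joined_refl[of y "V - (X \<union> common X)" E]
  unfolding core_def side_def common_def by auto

lemma bestD: "best X \<Longrightarrow> core X"
  unfolding best_def by auto

lemma side_V: "side X \<subseteq> V" "side X \<inter> X = {}" "side X \<inter> common X = {}"
  unfolding side_def by auto

lemma side_closed: "u \<in> side X \<Longrightarrow> t \<in> V \<Longrightarrow> t \<notin> X \<Longrightarrow> t \<notin> common X \<Longrightarrow> E u t \<Longrightarrow> t \<in> side X"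
  unfolding side_def using joined_extend_left[OF symE] E_sym by auto

lemma side_least:
  assumes "core X" "y \<in> C" "\<And>a b. a \<in> C \<Longrightarrow> b \<in> V - (X \<union> common X) \<Longrightarrow> E a b \<Longrightarrow> b \<in> C"
  shows "side X \<subseteq> C"
proof
  fix v assume "v \<in> side X"
  then have "joined E (V - (X \<union> common X)) y v" unfolding side_def using joined_sym[OF symE] by auto
  then show "v \<in> C" by (rule joined_closed) (use assms in auto)
qed

lemma side_path:
  assumes "core X" "v \<in> side X"
  obtains n where "spath E (side X) v y n"
proof -
  let ?C = "{w \<in> side X. joined E (side X) y w}"
  have "side X \<subseteq> ?C"
  proof (rule side_least[OF assms(1)])
    show "y \<in> ?C" using coreD(8)[OF assms(1)] by (auto intro: joined_refl)
    fix a b assume "a \<in> ?C" "b \<in> V - (X \<union> common X)" "E a b"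
    moreover from this have "b \<in> side X" using side_closed by blast
    ultimately show "b \<in> ?C" by (auto intro: joined_extend)
  qed
  then have "joined E (side X) v y" using assms(2) joined_sym[OF symE] by auto
  then show ?thesis using that unfolding joined_def by auto
qed

lemma ex_best: "\<exists>X. best X"
proof -
  obtain g where "g \<in> V" "E g x"
    using rooted_nbr[OF rooted_sym[OF root]] Vxy xV yV by (metis insert_commute)
  then have "g \<in> common {x}" unfolding common_def by (auto dest: E_sym)
  then have "1 \<le> card (common {x})" using finite_sets(2) card_0_eq[of "common {x}"]
    by (cases "card (common {x})") auto
  then have 1: "core {x}" unfolding core_def using xV xy by auto
  \<comment> \<open>The weight \<open>card V + 1\<close> exceeds every component size, so maximizing
    \<open>f\<close> is lexicographic maximization.\<close>
  define f where "f X = card X * (card V + 1) + card (side X)" for X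
  have side_le: "card (side X) \<le> card V" for X using side_V(1) finV card_mono by blast
  have "f X \<le> card V * (card V + 1) + card V" if "core X" for X
    unfolding f_def using card_mono[OF finV coreD(2)[OF that]] side_le[of X]
    by (intro add_mono mult_mono) auto
  then have "\<exists>X. core X \<and> (\<forall>X'. core X' \<longrightarrow> f X' \<le> f X)"
    using 1 by (intro ex_has_greatest_nat[where P = core and k = "{x}" and f = f
          and b = "Suc (card V * (card V + 1) + card V)"]) (auto simp: less_Suc_eq_le)
  then obtain X where X: "core X" "\<And>X'. core X' \<Longrightarrow> f X' \<le> f X" by auto
  have "card X' \<le> card X" if "core X'" for X'
  proof (rule ccontr)
    assume "\<not> card X' \<le> card X"
    then have "(card X + 1) * (card V + 1) \<le> card X' * (card V + 1)" by (intro mult_right_mono) auto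
    moreover have "(card X + 1) * (card V + 1) = card X * (card V + 1) + (card V + 1)" by simp
    ultimately show False using X(2)[OF that] side_le[of X] unfolding f_def by linarith
  qed
  moreover have "card (side X') \<le> card (side X)" if "core X'" "card X' = card X" for X'
    using X(2)[OF that(1)] that(2) unfolding f_def by auto
  ultimately show ?thesis using X(1) unfolding best_def by auto
qed

text \<open>This serves to exchange one vertex of \<open>X\<close>: if the component of
  \<open>y\<close> does not lose vertices, the new biclique is again optimal.\<close>

lemma best_switch:
  assumes "best X" "core X'" "card X' = card X" "side X \<subseteq> side X'"
  shows "best X'" "side X' = side X"
proof -
  have "card (side X') \<le> card (side X)" using assms unfolding best_def by auto
  then show 1: "side X' = side X" using card_seteq[OF finite_sets(3) assms(4)] by auto
  then show "best X'" using assms unfolding best_def by auto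
qed

text \<open>With more neighbours in \<open>common X\<close>, adding \<open>v\<close> to
  \<open>X\<close> would give a larger core.\<close>

lemma best_nbrs_common:
  assumes "best X" "v \<in> V" "v \<notin> X" "v \<noteq> y"
  shows "card (nbrs V E v \<inter> common X) \<le> card X"
proof (rule ccontr)
  assume neg: "\<not> ?thesis"
  note C = coreD[OF bestD[OF assms(1)]]
  have "nbrs V E v \<inter> common X \<subseteq> common (insert v X)" unfolding common_def nbrs_def by auto
  then have "card (nbrs V E v \<inter> common X) \<le> card (common (insert v X))"
    by (intro card_mono finite_sets)
  then have "core (insert v X)" unfolding core_def using neg C assms by auto
  then have "card (insert v X) \<le> card X" using assms(1) unfolding best_def by auto
  then show False using C assms by auto
qed

lemma nbrs_not_common:
  assumes "finite X" "v \<in> V" "v \<notin> common X"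
  shows "card (nbrs V E v \<inter> X) < card X"
  using assms by (intro psubset_card_mono) (auto simp: common_def nbrs_def dest: E_sym)

lemma biclique_core_common:
  assumes "x \<in> X" "X \<subseteq> V" "Y \<subseteq> common X" "card X \<le> card Y"
  shows "biclique_core V E x X Y"
  using assms finV symE irrE common_disjoint[of X] smaller
  by unfold_locales (auto simp: common_def)

section \<open>Path families leading to an exit vertex\<close>

text \<open>The vertices of \<open>W\<close> that reach \<open>c\<close> inside
  \<open>insert c W\<close> form a set attached to \<open>c\<close>. The vertex \<open>c\<close> may
  belong to \<open>common X\<close> as long as it is kept out of \<open>Y\<close>.\<close>

lemma component_prog:
  assumes X: "x \<in> X" "X \<subseteq> V" "Y \<subseteq> common X" "card X \<le> card Y"
    and W: "W \<subseteq> V" "W \<inter> X = {}" "W \<inter> common X = {}" "y \<notin> W" "d \<in> W" "E d c"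
    and c: "c \<in> V" "c \<notin> W" "c \<notin> X" "c \<notin> Y"
    and out: "\<And>p t. p \<in> W \<Longrightarrow> t \<in> V \<Longrightarrow> E p t \<Longrightarrow> t \<in> insert c W \<union> X \<union> Y"
    and bound: "\<And>p. p \<in> W \<Longrightarrow> card (nbrs V E p \<inter> Y) \<le> card X"
  shows "prog_paths E (X \<union> Y \<union> insert c W) x c m"
proof -
  interpret biclique_core V E x X Y m using biclique_core_common[OF X] .
  define P where "P = {v \<in> W. joined E (insert c W) v c}"
  have cP: "insert c P = {v \<in> insert c W. joined E (insert c W) v c}"
    unfolding P_def by (auto intro: joined_refl)
  have "d \<in> P" unfolding P_def using W joined_extend_left[OF symE, of "insert c W" c c d]
    by (auto intro: joined_refl)
  have "attached P c"
    unfolding attached_def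
  proof (intro conjI ballI allI impI)
    show "P \<subseteq> V" "P \<noteq> {}" "c \<in> V" "P \<inter> (X \<union> Y) = {}" "c \<notin> P \<union> X \<union> Y"
      using W c X(3) \<open>d \<in> P\<close> unfolding P_def by auto
  next
    fix p assume p: "p \<in> P"
    then have pW: "p \<in> W" unfolding P_def by auto
    show "nbrs V E p \<subseteq> insert c P \<union> X \<union> Y"
    proof
      fix t assume t: "t \<in> nbrs V E p"
      then have "t \<in> insert c W \<union> X \<union> Y" using out[OF pW] by (auto simp: nbrs_def)
      moreover have "t \<in> P" if "t \<in> W"
        using that p t joined_extend_left[OF symE, of "insert c W" p c t] E_sym
        unfolding P_def nbrs_def by auto
      ultimately show "t \<in> insert c P \<union> X \<union> Y" by auto
    qed
    show "card (nbrs V E p \<inter> X) < card X" using nbrs_not_common[OF finX] pW W by blast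
    show "card (nbrs V E p \<inter> Y) \<le> card X" using bound[OF pW] .
    show "2 * m \<le> card (nbrs V E p)" using degV pW W X(1) by blast
  next
    fix S q assume S: "S \<subseteq> P" "S \<noteq> {}"
    then have "S \<subseteq> V - {x, y}" using W X(1) unfolding P_def by auto
    then show "\<exists>u\<in>S. \<exists>t\<in>V - S. t \<noteq> q \<and> E u t" using root S(2) unfolding rooted_def by blast
  next
    fix S assume S: "S \<subseteq> P" "S \<noteq> {}"
    then show "\<exists>u\<in>S. \<exists>t\<in>insert c P - S. E u t"
      unfolding cP using c(2) by (intro joined_leaves[OF symE]) (auto simp: P_def)
  qed
  from attached_prog[OF this] show ?thesis
    by (rule prog_paths_mono) (auto simp: P_def)
qed

text \<open>Most contradictions below arise this way: \<open>component_prog\<close> or the biclique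
  leads to \<open>c\<close>, and a disjoint path leads on to \<open>y\<close>.\<close>

lemma no_tail:
  assumes "prog_paths E A x c m" "spath E B c y n" "A \<inter> B \<subseteq> {c}" "c \<noteq> y" "A \<union> B \<subseteq> V" "y \<notin> A"
  shows False
  using shared_paths_tail[OF symE assms] failure by auto

section \<open>Edges between an optimal biclique and the component of \<open>y\<close>\<close>

text \<open>With such an edge, \<open>attached_shared\<close> applies to the component without
  \<open>y\<close>, attached to \<open>y\<close>, and produces the excluded family.\<close>

lemma best_side_common:
  assumes "best X" "u \<in> side X" "u \<noteq> y" "t \<in> common X"
  shows "\<not> E u t"
proof
  assume ut: "E u t"
  note C = coreD[OF bestD[OF assms(1)]]
  interpret biclique_core V E x X "common X" m
    using biclique_core_common[OF C(1,2) subset_refl C(4)] .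
  define P where "P = side X - {y}"
  have yP: "insert y P = {v \<in> V - (X \<union> common X). joined E (V - (X \<union> common X)) v y}"
    using C(8) unfolding P_def side_def by auto
  have "attached P y"
    unfolding attached_def
  proof (intro conjI ballI allI impI)
    show "P \<subseteq> V" "P \<noteq> {}" "y \<in> V" "P \<inter> (X \<union> common X) = {}" "y \<notin> P \<union> X \<union> common X"
      using side_V[of X] C yV assms unfolding P_def by auto
  next
    fix p assume "p \<in> P"
    then have p: "p \<in> side X" "p \<noteq> y" "p \<in> V" "p \<notin> X" "p \<notin> common X"
      using side_V[of X] unfolding P_def by auto
    show "nbrs V E p \<subseteq> insert y P \<union> X \<union> common X"
      using side_closed[OF p(1)] unfolding P_def nbrs_def by auto
    show "card (nbrs V E p \<inter> X) < card X" using nbrs_not_common p C(5) by blast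
    show "card (nbrs V E p \<inter> common X) \<le> card X" using best_nbrs_common[OF assms(1)] p by blast
    show "2 * m \<le> card (nbrs V E p)" using degV p C(1) by blast
  next
    fix S q assume S: "S \<subseteq> P" "S \<noteq> {}"
    then have "S \<subseteq> V - {x, y}" using side_V[of X] C(1) unfolding P_def by auto
    then show "\<exists>u\<in>S. \<exists>t\<in>V - S. t \<noteq> q \<and> E u t" using root S(2) unfolding rooted_def by blast
  next
    fix S assume S: "S \<subseteq> P" "S \<noteq> {}"
    then show "\<exists>u\<in>S. \<exists>t\<in>insert y P - S. E u t"
      unfolding yP using C yV
      by (intro joined_leaves[OF symE]) (auto simp: P_def side_def)
  qed
  moreover have "\<exists>p\<in>P. \<exists>w\<in>common X. E p w" using assms ut unfolding P_def by auto
  ultimately obtain g where g: "g \<in> P" "E g y" "prog_paths E (X \<union> common X \<union> P) x g m"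
    using attached_shared by blast
  have "prog_paths E (V - {y}) x g m"
    using g(3) by (rule prog_paths_mono) (use C common_V side_V[of X] P_def in auto)
  then show False using failure g side_V[of X] unfolding shared_paths_def P_def by auto
qed

text \<open>Otherwise the non-root vertices of the component have all their neighbours in the
  component or at \<open>x\<close>. The component with \<open>x\<close> is then a smaller instance,
  as it misses \<open>common X\<close>, and its family serves for the whole graph.\<close>

lemma best_side_core:
  assumes "best X" "side X \<noteq> {y}"
  obtains e u where "e \<in> X" "e \<noteq> x" "u \<in> side X" "u \<noteq> y" "E e u"
proof (rule ccontr)
  assume neg: "\<not> thesis"
  note C = coreD[OF bestD[OF assms(1)]]
  let ?V = "insert x (side X)"
  have nb: "t \<in> ?V" if "u \<in> side X" "u \<noteq> y" "t \<in> V" "E u t" for u t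
    using that side_closed[of u X t] best_side_common[OF assms(1), of u t] neg E_sym
      \<open>\<And>u e. \<lbrakk>e \<in> X; e \<noteq> x; u \<in> side X; u \<noteq> y; E e u\<rbrakk> \<Longrightarrow> thesis\<close> by blast
  have sub: "?V - {x, y} \<subseteq> side X - {y}" "?V \<subseteq> V" using side_V[of X] xV by auto
  have xs: "x \<notin> side X" using side_V[of X] C(1) by auto
  have "rooted ?V E x y"
    unfolding rooted_def
  proof (intro allI impI)
    fix S q assume S: "S \<subseteq> ?V - {x, y}" "S \<noteq> {}"
    then have "S \<subseteq> V - {x, y}" using sub by auto
    then obtain u t where "u \<in> S" "t \<in> V" "t \<notin> S" "t \<noteq> q" "E u t" using rootedD[OF root _ S(2)] by metis
    moreover from this have "t \<in> ?V" using nb[of u t] S sub by auto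
    ultimately show "\<exists>u\<in>S. \<exists>t\<in>?V - S. t \<noteq> q \<and> E u t" by auto
  qed
  moreover have "2 * m \<le> card (nbrs ?V E v)" if "v \<in> ?V - {x, y}" for v
  proof -
    have "nbrs ?V E v = nbrs V E v" using that nb[of v] sub unfolding nbrs_def by auto
    then show ?thesis using degV[of v] that sub by auto
  qed
  moreover have "?V \<noteq> {x, y}" using assms(2) C(8) xs by auto
  ultimately have "rooted_graph ?V E x y m"
    unfolding rooted_graph_def using finite_sets(3) C(8) xy symE irrE nxy by auto
  moreover have "card ?V < card V"
  proof -
    have "card (common X) \<noteq> 0" using C(1,4,5) by (auto dest: card_0_eq)
    then obtain b where "b \<in> common X" by fastforce
    then have "b \<in> V" "b \<notin> ?V" using common_V[of X] side_V[of X] C(7) by auto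
    then show ?thesis using sub(2) finV by (intro psubset_card_mono) auto
  qed
  ultimately have "shared_paths ?V E x y m" using smaller by blast
  then obtain g where "g \<in> ?V - {y}" "E g y" "prog_paths E (?V - {y}) x g m"
    unfolding shared_paths_def by auto
  moreover from this(3) have "prog_paths E (V - {y}) x g m" by (rule prog_paths_mono) (use sub in auto)
  ultimately show False using failure sub(2) unfolding shared_paths_def by blast
qed

text \<open>If \<open>m \<le> card X\<close>, the biclique alone gives \<open>m\<close> paths to
  \<open>e\<close>. If \<open>common X\<close> is larger than \<open>X\<close>, it can spare
  \<open>e\<close>, which then serves as the exit vertex.\<close>

lemma best_side_singleton:
  assumes "best X" "side X = {y}" "e \<in> common X" "E e y"
  shows "card (common X) \<le> card X" "card X < m"
proof -
  note C = coreD[OF bestD[OF assms(1)]]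
  have e: "e \<in> V" "e \<noteq> y" "e \<noteq> x" "e \<notin> X" using assms C common_disjoint[of X] common_V[of X] by auto
  have tail: "spath E {e, y} e y 1" using assms e by (intro spath_edge) auto
  show m: "card X < m"
  proof (rule ccontr)
    assume "\<not> card X < m"
    then have "prog_paths E (X \<union> common X) x e m"
      using biclique_prog_across[OF C(5) finite_sets(2) common_disjoint symE _ C(1) assms(3) C(4)]
      by (auto intro: prog_paths_mono simp: common_def)
    from no_tail[OF this tail] show False using C e common_V yV by auto
  qed
  show "card (common X) \<le> card X"
  proof (rule ccontr)
    assume big: "\<not> card (common X) \<le> card X"
    let ?W = "V - (X \<union> common X \<union> {y})"
    \<comment> \<open>Besides \<open>y\<close>, \<open>e\<close> has at most \<open>card X\<close>
      neighbours in each class, which is fewer than \<open>2 * m\<close> in all because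
      \<open>card X < m\<close>.\<close>
    have "\<exists>d\<in>?W. E e d"
    proof (rule ccontr)
      assume "\<not> ?thesis"
      then have "nbrs V E e \<subseteq> X \<union> (nbrs V E e \<inter> common X) \<union> {y}" by (auto simp: nbrs_def)
      then have "card (nbrs V E e) \<le> card (X \<union> (nbrs V E e \<inter> common X) \<union> {y})"
        using C(5) finite_sets(2) by (intro card_mono) auto
      also have "\<dots> \<le> card X + card (nbrs V E e \<inter> common X) + card {y}"
        by (meson add_le_mono card_Un_le dual_order.trans order_refl)
      also have "\<dots> \<le> 2 * card X + 1" using best_nbrs_common[OF assms(1) e(1,4,2)] by auto
      finally show False using degV[OF e(1,3,2)] m by auto
    qed
    then obtain d where d: "d \<in> ?W" "E e d" by auto
    have "prog_paths E (X \<union> (common X - {e}) \<union> insert e ?W) x e m"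
    proof (rule component_prog[OF C(1,2) _ _ _ _ _ _ d(1)])
      fix p t assume p: "p \<in> ?W" "t \<in> V" "E p t"
      have "t \<noteq> y" using p assms(2) side_closed[of y X p] E_sym by auto
      then show "t \<in> insert e ?W \<union> X \<union> (common X - {e})" using p by auto
    next
      fix p assume p: "p \<in> ?W"
      have "card (nbrs V E p \<inter> (common X - {e})) \<le> card (nbrs V E p \<inter> common X)"
        using finite_sets(2) by (intro card_mono) auto
      also have "\<dots> \<le> card X" using best_nbrs_common[OF assms(1), of p] p by auto
      finally show "card (nbrs V E p \<inter> (common X - {e})) \<le> card X" .
    next
      show "card X \<le> card (common X - {e})" using big assms(3) finite_sets(2) by auto
    qed (use e d assms(3) E_sym in auto)
    from no_tail[OF this tail] show False using C e common_V yV by auto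
  qed
qed

text \<open>Here \<open>e\<close> serves as the way out to \<open>y\<close>, so it is removed from \<open>X\<close>. If the smaller biclique
  violated the degree bound, replacing \<open>e\<close> by the violating vertex would give another biclique with
  \<open>s\<close> maximal and a larger component of \<open>y\<close>.\<close>

lemma best_core_side:
  assumes X: "best X" and e: "e \<in> X" "e \<noteq> x" and u0: "u0 \<in> side X" "E e u0"
    and far: "side X = {y} \<or> (\<exists>u\<in>side X - {y}. E e u)"
  shows False
proof -
  note C = coreD[OF bestD[OF X]]
  let ?Y = "common X"
  define X1 where "X1 = X - {e}"
  \<comment> \<open>Dropping \<open>e\<close> from \<open>X\<close> can only enlarge the common
    neighbourhood; \<open>e\<close> and the component are kept out of it for the way to
    \<open>y\<close>.\<close>
  define Y1 where "Y1 = common X1 - insert e (side X)"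
  define W where "W = V - (X \<union> Y1 \<union> side X)"
  have eV: "e \<in> V" "e \<noteq> y" "e \<notin> ?Y" "e \<notin> side X"
    using e C common_disjoint[of X] side_V[of X] by auto
  have cX1: "card X = Suc (card X1)" unfolding X1_def by (rule card.remove[OF C(5) e(1)])
  have X1: "x \<in> X1" "X1 \<subseteq> V" "finite X1" "insert e X1 = X"
    using C(1,2,5) e unfolding X1_def by auto
  have YY1: "?Y \<subseteq> Y1" using eV(3) side_V[of X] unfolding Y1_def X1_def common_def by auto
  have finY1: "finite Y1" using finite_sets(2) unfolding Y1_def by auto
  have cardY1: "card X \<le> card Y1" using C(4) card_mono[OF finY1 YY1] by auto
  have yY1: "y \<notin> Y1" "x \<notin> Y1" using C(8) X1(1) E_irr unfolding Y1_def common_def by auto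
  \<comment> \<open>A violating \<open>v\<close> replaces \<open>e\<close>:
    \<open>insert v X1\<close> has at least \<open>card X\<close> common neighbours other than
    \<open>e\<close>, and its component of \<open>y\<close> contains the old one, so it is again
    optimal.\<close>
  have bound: "card (nbrs V E v \<inter> Y1) \<le> card X1" if v: "v \<in> V" "v \<notin> side X" "v \<notin> X" for v
  proof (rule ccontr)
    assume neg: "\<not> ?thesis"
    let ?X = "insert v X1"
    have vy: "v \<noteq> y" using v C(8) by auto
    have sub: "nbrs V E v \<inter> Y1 \<subseteq> common ?X - {e}" unfolding Y1_def common_def nbrs_def by auto
    have vX1: "v \<notin> X1" using v unfolding X1_def by auto
    have cX: "card ?X = card X" using X1 vX1 cX1 by auto
    have le: "card X \<le> card (common ?X - {e})"
      using card_mono[OF _ sub] finite_sets(2)[of ?X] neg cX1 by auto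
    also have "\<dots> \<le> card (common ?X)" using finite_sets(2) by (intro card_mono) auto
    finally have core: "core ?X" unfolding core_def using X1 C(3) v vy cX unfolding X1_def by auto
    \<comment> \<open>A vertex of the component adjacent to \<open>v\<close> would put
      \<open>v\<close> into the component or into \<open>common X\<close>; the latter contradicts
      \<open>best_side_common\<close>.\<close>
    have disj: "side X \<inter> common ?X = {}"
    proof (rule ccontr)
      assume "side X \<inter> common ?X \<noteq> {}"
      then obtain t where t: "t \<in> side X" "t \<in> common ?X" by auto
      have "E t v" using t(2) E_sym unfolding common_def by auto
      moreover have "t \<noteq> y" using t(2) coreD(6)[OF core] by auto
      ultimately show False
        using side_closed[OF t(1) v(1,3)] best_side_common[OF X t(1)] v(2) by blast
    qed
    have "side X \<subseteq> side X \<inter> side ?X"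
    proof (rule side_least[OF bestD[OF X]])
      show "y \<in> side X \<inter> side ?X" using C(8) coreD(8)[OF core] by auto
      fix a b assume ab: "a \<in> side X \<inter> side ?X" "b \<in> V - (X \<union> ?Y)" "E a b"
      then have b: "b \<in> side X" using side_closed[of a X b] by auto
      then have "b \<notin> ?X" "b \<notin> common ?X" using disj v side_V[of X] unfolding X1_def by auto
      then show "b \<in> side X \<inter> side ?X" using b side_closed[of a ?X b] ab by auto
    qed
    then have sideX: "best ?X" "side ?X = side X" using best_switch[OF X core cX] by auto
    \<comment> \<open>If \<open>e\<close> is a common neighbour of the new biclique, then
      \<open>far\<close> conflicts with \<open>best_side_common\<close>, or, when the component is
      \<open>{y}\<close>, \<open>best_side_singleton\<close> allows too few common neighbours.
      Otherwise \<open>e\<close> would join the component through \<open>u0\<close>.\<close>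
    show False
    proof (cases "e \<in> common ?X")
      case True
      show False
      proof (cases "side X = {y}")
        case True
        have "E e y" using u0 True by auto
        then have "card (common ?X) \<le> card ?X"
          using best_side_singleton(1)[OF sideX(1) _ \<open>e \<in> common ?X\<close>] sideX(2) True by auto
        moreover have "card (common ?X) = Suc (card (common ?X - {e}))"
          using \<open>e \<in> common ?X\<close> finite_sets(2) card.remove by metis
        ultimately show False using le cX by auto
      next
        case False
        then obtain u where "u \<in> side X" "u \<noteq> y" "E u e" using far E_sym by auto
        then show False using best_side_common[OF sideX(1)] sideX(2) \<open>e \<in> common ?X\<close> by auto
      qed
    next
      case False
      moreover have "e \<notin> ?X" using v e unfolding X1_def by auto
      ultimately have "e \<in> side ?X" using side_closed[of u0 ?X e] u0 E_sym eV sideX(2) by auto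
      then show False using sideX(2) eV by auto
    qed
  qed
  obtain n0 where "spath E (side X) u0 y n0" using side_path[OF bestD[OF X] u0(1)] .
  then have tail: "spath E (insert e (side X)) e y (Suc n0)"
    using u0 eV by (intro spath_step[of e _ E u0]) auto
  have W: "W \<subseteq> V" "W \<inter> X1 = {}" "y \<notin> W" "W \<inter> common X1 = {}"
    using C(8) e unfolding W_def Y1_def X1_def by auto
  have boundW: "card (nbrs V E p \<inter> Y1) \<le> card X1" if "p \<in> W" for p
    using bound[of p] that unfolding W_def by auto
  have out: "t \<in> W \<union> X \<union> Y1" if p: "p \<in> W" "t \<in> V" "E p t" for p t
  proof -
    have "p \<in> V" "p \<notin> X" "p \<notin> ?Y" "p \<notin> side X" using p(1) YY1 unfolding W_def by auto
    then have "t \<notin> side X" using side_closed[of t X p] E_sym[OF p(3)] by auto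
    then show ?thesis using p unfolding W_def by auto
  qed
  have XYV: "X1 \<union> Y1 \<subseteq> V" using X1 common_V[of X1] unfolding Y1_def by auto
  have YC: "Y1 \<subseteq> common X1" unfolding Y1_def by auto
  have eW: "e \<notin> X1" "e \<notin> Y1" "e \<notin> W" using e unfolding X1_def Y1_def W_def by auto
  have sd: "side X \<inter> X1 = {}" "side X \<inter> Y1 = {}" "side X \<inter> W = {}" "side X \<subseteq> V" "y \<in> side X"
    using side_V[of X] C(8) unfolding X1_def Y1_def W_def by auto
  \<comment> \<open>If \<open>e\<close> has a neighbour outside the biclique and the component, the
    family is led to \<open>e\<close>; otherwise to some \<open>b\<close> in
    \<open>common X\<close>, with way out \<open>b\<close>, \<open>e\<close> and then the
    component.\<close>
  show False
  proof (cases "\<exists>d\<in>V - (X \<union> ?Y \<union> side X). E e d")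
    case True
    then obtain d where d: "d \<in> V - (X \<union> ?Y \<union> side X)" "E e d" by auto
    have "d \<notin> Y1"
    proof
      assume "d \<in> Y1"
      then have "d \<in> ?Y" using d X1(4) unfolding Y1_def common_def by auto
      then show False using d by auto
    qed
    then have dW: "d \<in> W" using d unfolding W_def by auto
    have "prog_paths E (X1 \<union> Y1 \<union> insert e W) x e m"
    proof (rule component_prog[OF X1(1,2) YC _ W(1,2,4,3) dW E_sym[OF d(2)] eV(1)])
      show "e \<notin> W" "e \<notin> X1" "e \<notin> Y1" using e unfolding W_def X1_def Y1_def by auto
      show "card X1 \<le> card Y1" using cardY1 cX1 by auto
    qed (use out X1(4) boundW in auto)
    then show False
    proof (rule no_tail[OF _ tail])
      show "(X1 \<union> Y1 \<union> insert e W) \<inter> insert e (side X) \<subseteq> {e}"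
        "X1 \<union> Y1 \<union> insert e W \<union> insert e (side X) \<subseteq> V" "y \<notin> X1 \<union> Y1 \<union> insert e W"
        using sd XYV W(1) eV by blast+
    qed (fact eV)
  next
    case False
    have "?Y \<noteq> {}" using C(1,4,5) by (auto dest: card_0_eq)
    then obtain b where b: "b \<in> ?Y" by auto
    then have bV: "b \<in> V" "b \<noteq> x" "b \<noteq> y" "b \<notin> X" "b \<notin> side X" "b \<in> Y1" "E b e"
      using C common_V[of X] common_disjoint[of X] side_V[of X] YY1 e E_sym unfolding common_def by auto
    \<comment> \<open>More than \<open>m\<close> vertices in \<open>X\<close> would give
      \<open>m\<close> paths from \<open>x\<close> to \<open>e\<close> inside the biclique.\<close>
    have big: "card X \<le> m"
    proof (rule ccontr)
      assume "\<not> card X \<le> m"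
      then have "prog_paths E (X \<union> ?Y) x e m"
        using biclique_prog_within[OF C(5) finite_sets(2) common_disjoint symE _ C(1) e C(4)]
        by (auto intro: prog_paths_mono simp: common_def)
      then show False
        by (rule no_tail[OF _ tail]) (use eV side_V[of X] C common_V[of X] in auto)
    qed
    have bigy: "card X < m" if "E b y"
    proof (rule ccontr)
      assume "\<not> card X < m"
      then have "prog_paths E (X \<union> ?Y) x b m"
        using biclique_prog_across[OF C(5) finite_sets(2) common_disjoint symE _ C(1) b C(4)]
        by (auto intro: prog_paths_mono simp: common_def)
      moreover have "spath E {b, y} b y 1" using that bV by (intro spath_edge) auto
      ultimately show False
        by (rule no_tail) (use bV C common_V[of X] yV in auto)
    qed
    \<comment> \<open>Otherwise \<open>b\<close> has at most \<open>card X + (card X - 1)\<close>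
      neighbours, and one more if it is adjacent to \<open>y\<close>; \<open>big\<close> and
      \<open>bigy\<close> keep this below \<open>2 * m\<close>.\<close>
    have "\<exists>d\<in>W. E b d"
    proof (rule ccontr)
      assume neg: "\<not> ?thesis"
      have "t \<in> X \<union> (nbrs V E b \<inter> Y1) \<union> (if E b y then {y} else {})" if t: "t \<in> V" "E b t" for t
      proof (cases "t \<in> side X")
        case True
        then show ?thesis using best_side_common[OF X True _ b] t E_sym by auto
      next
        case False
        then show ?thesis using t neg unfolding W_def nbrs_def by auto
      qed
      then have "nbrs V E b \<subseteq> X \<union> (nbrs V E b \<inter> Y1) \<union> (if E b y then {y} else {})"
        unfolding nbrs_def by blast
      then have "card (nbrs V E b) \<le> card (X \<union> (nbrs V E b \<inter> Y1) \<union> (if E b y then {y} else {}))"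
        using C(5) finY1 by (intro card_mono) auto
      also have "\<dots> \<le> card X + card (nbrs V E b \<inter> Y1) + card (if E b y then {y} else {})"
        by (meson add_le_mono card_Un_le dual_order.trans order_refl)
      also have "\<dots> \<le> card X + card X1 + (if E b y then 1 else 0)"
        using bound[OF bV(1,5,4)] by auto
      finally show False using degV[OF bV(1-3)] big bigy cX1 by (auto split: if_splits)
    qed
    then obtain d where d: "d \<in> W" "E b d" by auto
    have tail': "spath E (insert b (insert e (side X))) b y (Suc (Suc n0))"
      using bV eV tail e by (intro spath_step[of b _ E e]) (auto simp: insert_Diff_if)
    have "prog_paths E (X1 \<union> (Y1 - {b}) \<union> insert b W) x b m"
    proof (rule component_prog[OF X1(1,2) _ _ W(1,2,4,3) d(1) E_sym[OF d(2)] bV(1)])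
      show "b \<notin> W" "b \<notin> X1" "b \<notin> Y1 - {b}" "Y1 - {b} \<subseteq> common X1"
        using bV YC unfolding W_def X1_def by auto
      show "card X1 \<le> card (Y1 - {b})" using cardY1 cX1 bV finY1 by auto
    next
      fix p t assume p: "p \<in> W" "t \<in> V" "E p t"
      have "p \<in> V - (X \<union> ?Y \<union> side X)" using p(1) YY1 unfolding W_def by auto
      then have "t \<noteq> e" using False p E_sym by auto
      then show "t \<in> insert b W \<union> X1 \<union> (Y1 - {b})" using out[OF p] unfolding X1_def by auto
    next
      fix p assume p: "p \<in> W"
      have "card (nbrs V E p \<inter> (Y1 - {b})) \<le> card (nbrs V E p \<inter> Y1)"
        using finY1 by (intro card_mono) auto
      then show "card (nbrs V E p \<inter> (Y1 - {b})) \<le> card X1" using boundW[OF p] by auto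
    qed
    then show False
    proof (rule no_tail[OF _ tail'])
      show "(X1 \<union> (Y1 - {b}) \<union> insert b W) \<inter> insert b (insert e (side X)) \<subseteq> {b}"
        "X1 \<union> (Y1 - {b}) \<union> insert b W \<union> insert b (insert e (side X)) \<subseteq> V"
        "y \<notin> X1 \<union> (Y1 - {b}) \<union> insert b W"
        using sd XYV W(1) eV(1) eW bV by blast+
    qed (fact bV)
  qed
qed

text \<open>The component of \<open>y\<close> is shown to be \<open>{y}\<close>, so all neighbours
  of \<open>y\<close> lie in \<open>common X\<close>. One of them, \<open>e\<close>, is set aside: a
  family is led to \<open>e\<close>, and the edge to \<open>y\<close> completes it.\<close>

lemma contradiction: False
proof -
  obtain X where X: "best X" using ex_best by auto
  note C = coreD[OF bestD[OF X]]
  let ?Y = "common X"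
  have y: "side X = {y}"
  proof (rule ccontr)
    assume "side X \<noteq> {y}"
    then obtain e u where "e \<in> X" "e \<noteq> x" "u \<in> side X" "u \<noteq> y" "E e u"
      using best_side_core[OF X] by metis
    then show False using best_core_side[OF X, of e u] by auto
  qed
  \<comment> \<open>A component \<open>{y}\<close> satisfies the last hypothesis of
    \<open>best_core_side\<close>. The claim covers all such \<open>Z\<close>, since it is also
    applied after an exchange.\<close>
  have noX: "\<not> E e y" if "best Z" "side Z = {y}" "e \<in> Z" for e Z
    using best_core_side[OF that(1,3), of y] that nxy by (cases "e = x") auto
  have yY: "t \<in> ?Y" if "t \<in> V" "E y t" for t
    using that side_closed[of y X t] y noX[OF X y, of t] E_sym E_irr by (cases "t = y") auto
  obtain e where e0: "e \<in> V" "e \<noteq> x" "e \<noteq> y" "E e y" using rooted_nbr[OF root Vxy xV yV] .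
  then have eY: "e \<in> ?Y" using yY E_sym by auto
  have sm: "card X < m" and Ys: "card ?Y \<le> card X"
    using best_side_singleton[OF X y eY e0(4)] by auto
  have eX: "e \<notin> X" using eY common_disjoint[of X] by auto
  \<comment> \<open>Otherwise \<open>e\<close> is the only neighbour of \<open>x\<close> and of
    \<open>y\<close>, hence the only exit of the remaining vertices.\<close>
  have "X \<noteq> {x}"
  proof
    assume Xx: "X = {x}"
    then have "card ?Y \<le> 1" using Ys by auto
    then have Ye: "?Y = {e}" using eY finite_sets(2)
      by (metis card_1_singletonE card_0_eq empty_iff le_antisym less_one not_less singletonD)
    have nx: "t = e" if "t \<in> V" "E x t" for t using that Ye Xx unfolding common_def by auto
    have "\<not> nbrs V E e \<subseteq> {x, y}"
    proof
      assume "nbrs V E e \<subseteq> {x, y}"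
      then have "card (nbrs V E e) \<le> card {x, y}" by (intro card_mono) auto
      then show False using degV[OF e0(1-3)] m2 xy by auto
    qed
    then obtain d where d: "d \<in> V" "d \<noteq> x" "d \<noteq> y" "E e d" unfolding nbrs_def by auto
    let ?S = "V - {x, y, e}"
    have "d \<in> ?S" using d E_irr by auto
    then obtain u t where ut: "u \<in> ?S" "t \<in> V" "t \<notin> ?S" "t \<noteq> e" "E u t"
      using rootedD[OF root, of ?S e] by blast
    then have "E t u" "t = x \<or> t = y" using E_sym by auto
    then show False using nx[of u] yY[of u] Ye ut by auto
  qed
  then obtain u where u: "u \<in> X" "u \<noteq> x" using C(1) by auto
  \<comment> \<open>The two classes have equal size, so setting \<open>e\<close> aside would make
    \<open>common X\<close> too small; dropping \<open>u\<close> from \<open>X\<close> restores the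
    inequality.\<close>
  define X1 where "X1 = X - {u}"
  define Y1 where "Y1 = common X1 - {e}"
  define W where "W = V - (X1 \<union> Y1 \<union> {e, y})"
  have cX1: "card X = Suc (card X1)" unfolding X1_def by (rule card.remove[OF C(5) u(1)])
  have X1: "x \<in> X1" "X1 \<subseteq> V" "finite X1" "y \<notin> X1" "e \<notin> X1"
    using C(1,2,3,5) u eX unfolding X1_def by auto
  have YY1: "?Y - {e} \<subseteq> Y1" unfolding Y1_def X1_def common_def by auto
  have finY1: "finite Y1" using finite_sets(2) unfolding Y1_def by auto
  have cardY1: "card X1 \<le> card Y1"
    using card_mono[OF finY1 YY1] C(4) eY finite_sets(2)[of X] cX1 by auto
  have yY1: "y \<notin> Y1" using X1(1) nxy unfolding Y1_def common_def by auto
  have switch: "best (insert v X1)" "side (insert v X1) = {y}" "card (insert v X1) = card X"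
    "card X \<le> card (common (insert v X1) - {e})"
    if v: "v \<in> V" "v \<notin> X1" "v \<noteq> y" "\<not> card (nbrs V E v \<inter> Y1) \<le> card X1" for v
  proof -
    let ?X = "insert v X1"
    have sub: "nbrs V E v \<inter> Y1 \<subseteq> common ?X - {e}" unfolding Y1_def common_def nbrs_def by auto
    show cX: "card ?X = card X" using X1 v cX1 by auto
    show le: "card X \<le> card (common ?X - {e})"
      using card_mono[OF _ sub] finite_sets(2)[of ?X] v(4) cX1 by auto
    also have "\<dots> \<le> card (common ?X)" using finite_sets(2) by (intro card_mono) auto
    finally have core: "core ?X" unfolding core_def using X1 v cX by auto
    then show "best ?X" "side ?X = {y}" using best_switch[OF X core cX] y coreD(8)[OF core] by auto
  qed
  have bound: "card (nbrs V E v \<inter> Y1) \<le> card X1" if v: "v \<in> V" "v \<notin> X1" "v \<noteq> y" "v \<noteq> e" for v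
  proof (rule ccontr)
    assume "\<not> ?thesis"
    note sw = switch[OF v(1-3) this]
    show False
    proof (cases "e \<in> common (insert v X1)")
      case True
      then have "card (common (insert v X1)) \<le> card (insert v X1)"
        using best_side_singleton(1)[OF sw(1,2)] e0 by auto
      moreover have "card (common (insert v X1)) = Suc (card (common (insert v X1) - {e}))"
        using True finite_sets(2) card.remove by metis
      ultimately show False using sw by auto
    next
      case False
      then have "e \<in> side (insert v X1)"
        using side_closed[of y "insert v X1" e] sw(2) e0 E_sym X1(5) v(4) by auto
      then show False using sw(2) e0 by auto
    qed
  qed
  \<comment> \<open>Otherwise exchanging \<open>u\<close> for \<open>e\<close> gives an optimal
    biclique with a neighbour of \<open>y\<close> in its first class, against
    \<open>noX\<close>.\<close>
  have bounde: "card (nbrs V E e \<inter> Y1) \<le> card X1"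
  proof (rule ccontr)
    assume "\<not> ?thesis"
    note sw = switch[OF e0(1) X1(5) e0(3) this]
    show False using noX[OF sw(1,2), of e] e0 by auto
  qed
  \<comment> \<open>Otherwise \<open>e\<close> has at most \<open>2 * (card X - 1) + 1\<close>
    neighbours, fewer than \<open>2 * m\<close>.\<close>
  have "\<exists>d\<in>W. E e d"
  proof (rule ccontr)
    assume neg: "\<not> ?thesis"
    have "nbrs V E e \<subseteq> X1 \<union> (nbrs V E e \<inter> Y1) \<union> {y}"
      using neg E_irr[of e] unfolding W_def nbrs_def by auto
    then have "card (nbrs V E e) \<le> card (X1 \<union> (nbrs V E e \<inter> Y1) \<union> {y})"
      using X1(3) finY1 by (intro card_mono) auto
    also have "\<dots> \<le> card X1 + card (nbrs V E e \<inter> Y1) + card {y}"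
      by (meson add_le_mono card_Un_le dual_order.trans order_refl)
    also have "\<dots> \<le> card X1 + card X1 + 1" using bounde by auto
    finally show False using degV[OF e0(1-3)] sm cX1 by auto
  qed
  then obtain d where d: "d \<in> W" "E e d" by auto
  have W: "W \<subseteq> V" "W \<inter> X1 = {}" "W \<inter> common X1 = {}" "y \<notin> W"
    unfolding W_def Y1_def by auto
  have "prog_paths E (X1 \<union> Y1 \<union> insert e W) x e m"
  proof (rule component_prog[OF X1(1,2) _ cardY1 W d(1) E_sym[OF d(2)] e0(1)])
    show "e \<notin> W" "e \<notin> X1" "e \<notin> Y1" "Y1 \<subseteq> common X1" using X1(5) unfolding W_def Y1_def by auto
  next
    fix p t assume p: "p \<in> W" "t \<in> V" "E p t"
    then have "t \<noteq> y" using yY[of p] YY1 E_sym[OF p(3)] unfolding W_def by auto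
    then show "t \<in> insert e W \<union> X1 \<union> Y1" using p unfolding W_def by auto
  next
    fix p assume "p \<in> W"
    then show "card (nbrs V E p \<inter> Y1) \<le> card X1" using bound[of p] unfolding W_def by auto
  qed
  moreover have "spath E {e, y} e y 1" using e0 by (intro spath_edge) auto
  ultimately show False
    by (rule no_tail) (use e0 X1 W yY1 yV common_V[of X1] in \<open>auto simp: Y1_def\<close>)
qed

end

theorem rooted_graph_shared_paths:
  "rooted_graph V E x y m \<Longrightarrow> shared_paths V E x y m"
proof (induction "card V" arbitrary: V E x y m rule: less_induct)
  case less
  show ?case
  proof (cases "m \<le> 1")
    case True
    then show ?thesis using shared_paths_one[OF less.prems] by auto
  next
    case False
    show ?thesis
    proof (rule ccontr)
      assume "\<not> ?thesis"
      then interpret minimal_failure V E x y m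
        using less False by unfold_locales auto
      show False by (rule contradiction)
    qed
  qed
qed

section \<open>Parities of paths in rooted graphs\<close>

lemma spath_imp_wpath:
  "spath (\<lambda>u v. \<exists>k. E u v k) A u v n \<Longrightarrow> \<exists>k. wpath E A u v k"
proof (induction rule: spath_induct)
  case (step u A v w n)
  then show ?case by (auto intro: wpath_step)
qed (auto intro: wpath_refl)

section \<open>Parity balance in graphs with edge lengths\<close>

text \<open>A 2-colouring in which exactly the edges of odd length change colour; for unit lengths
  this is bipartiteness.\<close>

definition balanced :: "'a set \<Rightarrow> ('a \<Rightarrow> 'a \<Rightarrow> nat \<Rightarrow> bool) \<Rightarrow> bool" where
  "balanced V E \<longleftrightarrow>
     (\<exists>col :: 'a \<Rightarrow> bool. \<forall>u\<in>V. \<forall>v\<in>V. \<forall>k. E u v k \<longrightarrow> (odd k \<longleftrightarrow> col u \<noteq> col v))"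

lemma balancedE:
  fixes V :: "'a set"
  assumes "balanced V E"
  obtains col :: "'a \<Rightarrow> bool" where "\<And>u v k. u \<in> V \<Longrightarrow> v \<in> V \<Longrightarrow> E u v k \<Longrightarrow> odd k \<longleftrightarrow> col u \<noteq> col v"
proof -
  from assms obtain col :: "'a \<Rightarrow> bool" where "\<forall>u\<in>V. \<forall>v\<in>V. \<forall>k. E u v k \<longrightarrow> (odd k \<longleftrightarrow> col u \<noteq> col v)"
    unfolding balanced_def by (elim exE)
  then show ?thesis by (intro that[of col]) simp
qed

definition both_parities :: "'a set \<Rightarrow> ('a \<Rightarrow> 'a \<Rightarrow> nat \<Rightarrow> bool) \<Rightarrow> 'a \<Rightarrow> 'a \<Rightarrow> bool" where
  "both_parities V E x y \<longleftrightarrow> (\<forall>b. \<exists>n. wpath E V x y n \<and> (odd n \<longleftrightarrow> b))"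

text \<open>Contraction of \<open>v\<close> into \<open>x\<close> along an edge of length \<open>b\<close>: an edge at \<open>v\<close> becomes an edge at
  \<open>x\<close> that is longer by \<open>b\<close>.\<close>

definition merge :: "('a \<Rightarrow> 'a \<Rightarrow> nat \<Rightarrow> bool) \<Rightarrow> 'a \<Rightarrow> 'a \<Rightarrow> nat \<Rightarrow> 'a \<Rightarrow> 'a \<Rightarrow> nat \<Rightarrow> bool" where
  "merge E x v b s t k \<longleftrightarrow> s \<noteq> v \<and> t \<noteq> v \<and>
     (E s t k \<or> s = x \<and> t \<noteq> x \<and> (\<exists>j. E v t j \<and> k = b + j) \<or>
      t = x \<and> s \<noteq> x \<and> (\<exists>j. E v s j \<and> k = b + j))"

text \<open>A simple path visits \<open>x\<close> only at its start, so at most its first edge stems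
  from \<open>v\<close>; that edge is expanded into a step of length \<open>b\<close> to
  \<open>v\<close> and an edge at \<open>v\<close>.\<close>

lemma merge_both_parities:
  assumes "both_parities (V - {v}) (merge E x v b) x y" "E x v b" "x \<in> V" "v \<in> V" "x \<noteq> y" "x \<noteq> v"
  shows "both_parities V E x y"
  unfolding both_parities_def
proof
  fix c
  obtain n where n: "wpath (merge E x v b) (V - {v}) x y n" "odd n \<longleftrightarrow> c"
    using assms(1) unfolding both_parities_def by blast
  from n(1) have "wpath E V x y n"
  proof (cases rule: wpath.cases)
    case (wpath_step t k j)
    let ?A = "V - {v} - {x}"
    have t: "wpath E ?A t y j"
      using wpath_step(4) by (rule wpath_mono_rel) (auto simp: merge_def)
    from wpath_step(3) consider "E x t k" | i where "E v t i" "k = b + i"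
      using wpath_endpoints[OF wpath_step(4)] by (auto simp: merge_def)
    then show ?thesis
    proof cases
      case 1
      have "wpath E (V - {x}) t y j" using t by (rule wpath_mono) auto
      then show ?thesis unfolding wpath_step(1) using assms 1 by (intro wpath.wpath_step)
    next
      case 2
      have "V - {x} - {v} = ?A" by auto
      then have "wpath E (V - {x}) v y (i + j)"
        using assms t 2 by (intro wpath.wpath_step[of v "V - {x}" E t]) auto
      then have "wpath E V x y (b + (i + j))"
        using assms by (intro wpath.wpath_step[of x V E v])
      then show ?thesis unfolding wpath_step(1) 2 by (simp add: add.assoc)
    qed
  qed (use assms in auto)
  then show "\<exists>n. wpath E V x y n \<and> (odd n \<longleftrightarrow> c)" using n(2) by blast
qed

text \<open>\<open>v\<close> receives the colour demanded by the contracted edge. An edge at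
  \<open>v\<close> was shifted by \<open>b\<close>, so the condition at \<open>x\<close> turns into
  the one at \<open>v\<close>.\<close>

lemma merge_balanced:
  fixes V :: "'a set"
  assumes "balanced (V - {v}) (merge E x v b)" "\<And>k. E x v k \<Longrightarrow> odd k \<longleftrightarrow> odd b" "x \<in> V" "x \<noteq> v"
    and sym: "\<And>s t k. E s t k \<Longrightarrow> E t s k" and irr: "\<And>s k. \<not> E s s k"
  shows "balanced V E"
proof -
  obtain col :: "'a \<Rightarrow> bool" where col: "\<And>s t k. s \<in> V - {v} \<Longrightarrow> t \<in> V - {v} \<Longrightarrow> merge E x v b s t k \<Longrightarrow>
      (odd k \<longleftrightarrow> col s \<noteq> col t)"
    using balancedE[OF assms(1)] by blast
  define col' where "col' = col(v := (col x \<noteq> odd b))"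
  have vt: "odd k \<longleftrightarrow> col' v \<noteq> col' t" if t: "t \<in> V" "E v t k" for t k
  proof (cases "t = x")
    case True
    then show ?thesis using assms(2)[OF sym] t assms(4) unfolding col'_def by auto
  next
    case False
    have "t \<noteq> v" using t irr by auto
    moreover have "merge E x v b x t (b + k)" using False t assms(4) irr unfolding merge_def by auto
    ultimately have "odd (b + k) \<longleftrightarrow> col x \<noteq> col t" using col[of x t "b + k"] t assms by auto
    then show ?thesis using \<open>t \<noteq> v\<close> unfolding col'_def by auto
  qed
  have "odd k \<longleftrightarrow> col' s \<noteq> col' t" if st: "s \<in> V" "t \<in> V" "E s t k" for s t k
  proof -
    consider "s = v" | "t = v" | "s \<noteq> v" "t \<noteq> v" by auto
    then show ?thesis
    proof cases
      case 1 then show ?thesis using vt st by auto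
    next
      case 2 then show ?thesis using vt[OF st(1) sym] st by auto
    next
      case 3
      then show ?thesis using col[of s t k] st unfolding col'_def merge_def by auto
    qed
  qed
  then show ?thesis unfolding balanced_def by blast
qed

text \<open>The edge between \<open>x\<close> and \<open>v\<close> fixes the relation of their
  colours on both parts, so flipping one colouring if necessary makes them agree at both
  vertices.\<close>

lemma balanced_glue:
  fixes V :: "'a set"
  assumes "balanced (insert x (insert v S)) E" "balanced (V - S) E" "E x v b" "x \<in> V - S" "v \<in> V - S"
    and out: "\<And>u t k. u \<in> S \<Longrightarrow> t \<in> V - S \<Longrightarrow> E u t k \<Longrightarrow> t = x \<or> t = v"
    and sym: "\<And>s t k. E s t k \<Longrightarrow> E t s k"
  shows "balanced V E"
proof -
  obtain c1 :: "'a \<Rightarrow> bool" where c1: "\<And>s t k. s \<in> insert x (insert v S) \<Longrightarrow> t \<in> insert x (insert v S) \<Longrightarrow> E s t k \<Longrightarrow>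
      (odd k \<longleftrightarrow> c1 s \<noteq> c1 t)"
    using balancedE[OF assms(1)] by blast
  obtain c2 :: "'a \<Rightarrow> bool" where c2: "\<And>s t k. s \<in> V - S \<Longrightarrow> t \<in> V - S \<Longrightarrow> E s t k \<Longrightarrow> (odd k \<longleftrightarrow> c2 s \<noteq> c2 t)"
    using balancedE[OF assms(2)] by blast
  define c3 where "c3 t = (c1 t \<noteq> (c1 x \<noteq> c2 x))" for t
  have agree: "c3 x = c2 x" "c3 v = c2 v"
    using c1[of x v b] c2[of x v b] assms(3-5) unfolding c3_def by auto
  define col where "col t = (if t \<in> S then c3 t else c2 t)" for t
  have c3: "odd k \<longleftrightarrow> c3 s \<noteq> c3 t"
    if "s \<in> insert x (insert v S)" "t \<in> insert x (insert v S)" "E s t k" for s t k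
    using c1[OF that] unfolding c3_def by auto
  have colc3: "col t = c3 t" if "t \<in> insert x (insert v S)" for t
    using that agree assms(4,5) unfolding col_def by auto
  have "odd k \<longleftrightarrow> col s \<noteq> col t" if st: "s \<in> V" "t \<in> V" "E s t k" for s t k
  proof (cases "s \<in> S \<or> t \<in> S")
    case True
    then have "s \<in> insert x (insert v S)" "t \<in> insert x (insert v S)"
      using out[of s t k] out[of t s k] sym st by auto
    then show ?thesis using c3[OF _ _ st(3)] colc3 by auto
  next
    case False
    then show ?thesis using c2[of s t k] st unfolding col_def by auto
  qed
  then show ?thesis unfolding balanced_def by blast
qed

text \<open>Induction by contracting an edge from \<open>x\<close> to \<open>v\<close>. If the
  result is not rooted, some set \<open>S\<close> has outside neighbours only in
  \<open>{x, v}\<close>. Then \<open>S\<close> with roots \<open>x\<close>, \<open>v\<close> and the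
  graph without \<open>S\<close> with roots \<open>x\<close>, \<open>y\<close> are treated
  separately.\<close>

lemma balanced_or_both_parities:
  assumes "finite V" "x \<in> V" "y \<in> V" "x \<noteq> y" "\<And>s t k. E s t k \<Longrightarrow> E t s k" "\<And>s k. \<not> E s s k"
    and "rooted V (\<lambda>s t. \<exists>k. E s t k) x y"
  shows "balanced V E \<or> both_parities V E x y"
  using assms
proof (induction "card V" arbitrary: V E x y rule: less_induct)
  case less
  note fin = less.prems(1) and x = less.prems(2) and y = less.prems(3) and xy = less.prems(4)
    and sym = less.prems(5) and irr = less.prems(6) and root = less.prems(7)
  let ?R = "\<lambda>s t. \<exists>k. E s t k"
  have symR: "symp ?R" using sym by (auto intro!: sympI)
  show ?case
  proof (cases "V = {x, y}")
    case True
    show ?thesis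
    proof (cases "\<exists>j k. E x y j \<and> E x y k \<and> odd j \<and> even k")
      case True
      then obtain j k where jk: "E x y j" "E x y k" "odd j" "even k" by auto
      then have "wpath E V x y j" "wpath E V x y k"
        using xy \<open>V = {x, y}\<close> by (auto intro: wpath_edge)
      then show ?thesis using jk unfolding both_parities_def by metis
    next
      case False
      define col where "col u \<longleftrightarrow> u = y \<and> (\<exists>j. E x y j \<and> odd j)" for u
      have "odd k \<longleftrightarrow> col u \<noteq> col v" if "u \<in> V" "v \<in> V" "E u v k" for u v k
        using that False sym[of y x] irr xy \<open>V = {x, y}\<close> unfolding col_def by auto
      then show ?thesis unfolding balanced_def by blast
    qed
  next
    case nontriv: False
    then obtain v b where v: "v \<in> V" "v \<noteq> x" "v \<noteq> y" and xv: "E x v b"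
      using rooted_nbr[OF rooted_sym[OF root]] x y sym by (metis insert_commute)
    obtain n0 where n0: "wpath E (V - {x}) v y n0"
      using joined_sym[OF symR rooted_joined[OF rooted_sym[OF root] symR y xy[symmetric] v(1,2)]]
      unfolding joined_def by (elim exE) (drule spath_imp_wpath, elim exE)
    show ?thesis
    proof (cases "\<exists>k. E x v k \<and> (odd k \<longleftrightarrow> even b)")
      case True
      then obtain k where k: "E x v k" "odd k \<longleftrightarrow> even b" by auto
      have "wpath E V x y (b + n0)" "wpath E V x y (k + n0)"
        using n0 k x xv by (auto intro: wpath_step)
      moreover have "odd (b + n0) \<longleftrightarrow> even (k + n0)" using k(2) by auto
      ultimately show ?thesis unfolding both_parities_def by metis
    next
      case False
      then have same: "odd k \<longleftrightarrow> odd b" if "E x v k" for k using that by auto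
      let ?M = "merge E x v b"
      have symM: "\<And>s t k. ?M s t k \<Longrightarrow> ?M t s k" and irrM: "\<And>s k. \<not> ?M s s k"
        using sym irr unfolding merge_def by auto
      show ?thesis
      proof (cases "rooted (V - {v}) (\<lambda>s t. \<exists>k. ?M s t k) x y")
        case True
        have "card (V - {v}) < card V" using fin v by (intro psubset_card_mono) auto
        then have "balanced (V - {v}) ?M \<or> both_parities (V - {v}) ?M x y"
          using less.hyps[of "V - {v}" x y ?M] fin x y xy v symM irrM True by auto
        then show ?thesis
        proof
          assume "balanced (V - {v}) ?M"
          then have "balanced V E" by (rule merge_balanced) (use same x v sym irr in auto)
          then show ?thesis ..
        next
          assume "both_parities (V - {v}) ?M x y"
          then have "both_parities V E x y" by (rule merge_both_parities) (use xv x v xy in auto)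
          then show ?thesis ..
        qed
      next
        case False
        then obtain S q where S: "S \<subseteq> V - {v} - {x, y}" "S \<noteq> {}"
          and q: "\<And>u t k. u \<in> S \<Longrightarrow> t \<in> V - {v} - S \<Longrightarrow> t \<noteq> q \<Longrightarrow> \<not> ?M u t k"
          unfolding rooted_def by blast
        have SV: "S \<subseteq> V - {x, y}" using S by auto
        \<comment> \<open>Exits of \<open>S\<close> survive the contraction, those to
          \<open>v\<close> as exits to \<open>x\<close>; so only exits at the merged vertex can have
          collapsed into one.\<close>
        have "q = x"
        proof (rule ccontr)
          assume "q \<noteq> x"
          from rootedD[OF root SV S(2), of q]
          obtain u t where "u \<in> S" "t \<in> V" "t \<notin> S" "t \<noteq> q" "?R u t" .
          then obtain k where ut: "u \<in> S" "t \<in> V" "t \<notin> S" "t \<noteq> q" "E u t k" by auto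
          show False
          proof (cases "t = v")
            case True
            then have "?M u x (b + k)" using ut sym S v unfolding merge_def by auto
            then show False using q[of u x] ut S x v \<open>q \<noteq> x\<close> by auto
          next
            case False
            then have "?M u t k" using ut S unfolding merge_def by auto
            then show False using q[of u t] ut False by auto
          qed
        qed
        have out: "t = x \<or> t = v" if "u \<in> S" "t \<in> V - S" "E u t k" for u t k
        proof (rule ccontr)
          assume "\<not> ?thesis"
          moreover from this have "?M u t k" using that S unfolding merge_def by auto
          ultimately show False using q[of u t k] that \<open>q = x\<close> by auto
        qed
        let ?A = "V - S - {x}"
        \<comment> \<open>Otherwise the vertices other than \<open>x\<close> outside the component
          of \<open>y\<close> would have \<open>x\<close> as their only exit, since edges leaving
          \<open>S\<close> lead to \<open>x\<close> or \<open>v\<close>.\<close>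
        have "joined ?R ?A v y"
        proof (rule ccontr)
          assume neg: "\<not> ?thesis"
          define C where "C = {t \<in> ?A. joined ?R ?A t y}"
          have yC: "y \<in> C" using y S xy unfolding C_def by (auto intro: joined_refl)
          have "v \<in> V - {x} - C" using v neg unfolding C_def by auto
          then have ne: "V - {x} - C \<subseteq> V - {x, y}" "V - {x} - C \<noteq> {}" using yC by auto
          obtain u t where "u \<in> V - {x} - C" "t \<in> V" "t \<notin> V - {x} - C" "t \<noteq> x" "?R u t"
            by (rule rootedD[OF root ne, of x])
          then obtain k where ut:
            "u \<in> V - {x} - C" "t \<in> V" "t \<notin> V - {x} - C" "t \<noteq> x" "E u t k" by auto
          then have tC: "t \<in> C" "t \<notin> S" unfolding C_def by auto
          show False
          proof (cases "u \<in> S")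
            case True
            then have "t = v" using out[OF True _ ut(5)] ut tC by auto
            then show False using tC neg unfolding C_def by auto
          next
            case False
            then have "joined ?R ?A u y"
              using tC ut joined_extend_left[OF symR, of ?A t y u] unfolding C_def by auto
            then show False using ut False unfolding C_def by auto
          qed
        qed
        then obtain n1 where n1: "wpath E ?A v y n1"
          unfolding joined_def by (elim exE) (drule spath_imp_wpath, elim exE)
        let ?V1 = "insert x (insert v S)"
        have V1: "?V1 - {x, v} = S" "?V1 \<subseteq> V" using S x v by auto
        have "rooted ?V1 ?R x v"
          unfolding rooted_def V1
        proof (intro allI impI)
          fix S1 q' assume S1: "S1 \<subseteq> S" "S1 \<noteq> {}"
          then have "S1 \<subseteq> V - {x, y}" using SV by auto
          from rootedD[OF root this S1(2), of q']
          obtain u t where "u \<in> S1" "t \<in> V" "t \<notin> S1" "t \<noteq> q'" "?R u t" .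
          then obtain k where ut: "u \<in> S1" "t \<in> V" "t \<notin> S1" "t \<noteq> q'" "E u t k" by auto
          then have "t \<in> ?V1" using out[of u t k] S1 by auto
          then show "\<exists>u\<in>S1. \<exists>t\<in>?V1 - S1. t \<noteq> q' \<and> ?R u t" using ut by auto
        qed
        moreover have "card ?V1 < card V"
          using V1 fin y S xy v by (intro psubset_card_mono) auto
        ultimately have IH1: "balanced ?V1 E \<or> both_parities ?V1 E x v"
          using less.hyps[of ?V1 x v E] finite_subset[OF V1(2) fin] v sym irr by auto
        have "rooted (V - S) ?R x y"
          unfolding rooted_def
        proof (intro allI impI)
          fix S2 q' assume S2: "S2 \<subseteq> V - S - {x, y}" "S2 \<noteq> {}"
          show "\<exists>u\<in>S2. \<exists>t\<in>V - S - S2. t \<noteq> q' \<and> ?R u t"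
          proof (cases "v \<in> S2")
            case True
            \<comment> \<open>\<open>S\<close> is added so that the exit does not lead into
              \<open>S\<close>. If the exit starts in \<open>S\<close>, it is \<open>x\<close>,
              which is also adjacent to \<open>v\<close> in \<open>S2\<close>.\<close>
            have ne: "S2 \<union> S \<subseteq> V - {x, y}" "S2 \<union> S \<noteq> {}" using S2 SV by auto
            from rootedD[OF root ne, of q']
            obtain u t where "u \<in> S2 \<union> S" "t \<in> V" "t \<notin> S2 \<union> S" "t \<noteq> q'" "?R u t" .
            then obtain k where ut: "u \<in> S2 \<union> S" "t \<in> V" "t \<notin> S2 \<union> S" "t \<noteq> q'" "E u t k"
              by auto
            show ?thesis
            proof (cases "u \<in> S2")
              case True
              then show ?thesis using ut by blast
            next
              case False
              then have "t = x" using out[of u t k] ut \<open>v \<in> S2\<close> by auto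
              then show ?thesis using ut \<open>v \<in> S2\<close> sym[OF xv] by blast
            qed
          next
            case False
            have "S2 \<subseteq> V - {x, y}" using S2 by auto
            from rootedD[OF root this S2(2), of q']
            obtain u t where "u \<in> S2" "t \<in> V" "t \<notin> S2" "t \<noteq> q'" "?R u t" .
            then obtain k where ut: "u \<in> S2" "t \<in> V" "t \<notin> S2" "t \<noteq> q'" "E u t k" by auto
            have "t \<notin> S"
            proof
              assume "t \<in> S"
              then have "u = x \<or> u = v" using out[OF _ _ sym[OF ut(5)]] ut S2 by auto
              then show False using ut S2 False by auto
            qed
            then show ?thesis using ut by blast
          qed
        qed
        moreover have "card (V - S) < card V" using S fin by (intro psubset_card_mono) auto
        ultimately have IH2: "balanced (V - S) E \<or> both_parities (V - S) E x y"
          using less.hyps[of "V - S" x y E] fin x y xy S sym irr by auto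
        have 1: ?thesis if both: "both_parities ?V1 E x v"
        proof -
          have "\<exists>n. wpath E V x y n \<and> (odd n \<longleftrightarrow> c)" for c
          proof -
            obtain n where n: "wpath E ?V1 x v n" "odd n \<longleftrightarrow> (c \<noteq> odd n1)"
              using both[unfolded both_parities_def, rule_format, of "c \<noteq> odd n1"] by auto
            have "wpath E (?V1 \<union> ?A) x y (n + n1)" using n(1) n1 by (rule wpath_append) auto
            then have "wpath E V x y (n + n1)" by (rule wpath_mono) (use V1 in auto)
            then show ?thesis using n(2) by (intro exI[of _ "n + n1"]) auto
          qed
          then show ?thesis unfolding both_parities_def by auto
        qed
        have 2: ?thesis if "both_parities (V - S) E x y"
        proof -
          have "wpath E V x y n" if "wpath E (V - S) x y n" for n
            using that by (rule wpath_mono) auto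
          then show ?thesis using that unfolding both_parities_def by blast
        qed
        have "balanced V E" if "balanced ?V1 E" "balanced (V - S) E"
          by (rule balanced_glue[OF that xv]) (use x v S out sym in auto)
        then show ?thesis using 1 2 IH1 IH2 by auto
      qed
    qed
  qed
qed

lemma rooted_colouring_or_parities:
  fixes V :: "'a set"
  assumes "finite V" "x \<in> V" "y \<in> V" "x \<noteq> y" "symp E" "irreflp E" "rooted V E x y"
  obtains (colouring) col :: "'a \<Rightarrow> bool" where "\<And>u v. u \<in> V \<Longrightarrow> v \<in> V \<Longrightarrow> E u v \<Longrightarrow> col u \<noteq> col v"
  | (parities) "\<And>b. \<exists>n. spath E V x y n \<and> (odd n \<longleftrightarrow> b)"
proof -
  let ?E = "\<lambda>u v k. E u v \<and> k = (1 :: nat)"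
  have "balanced V ?E \<or> both_parities V ?E x y"
    using assms by (intro balanced_or_both_parities) (auto dest: sympD irreflpD)
  then show ?thesis
  proof
    assume "balanced V ?E"
    then show ?thesis
    proof (rule balancedE)
      fix col :: "'a \<Rightarrow> bool"
      assume "\<And>u v k. u \<in> V \<Longrightarrow> v \<in> V \<Longrightarrow> ?E u v k \<Longrightarrow> odd k \<longleftrightarrow> col u \<noteq> col v"
      then show ?thesis by (intro colouring[of col]) auto
    qed
  next
    assume "both_parities V ?E x y"
    then show ?thesis by (intro parities) (auto simp: both_parities_def spath_def)
  qed
qed

lemma spath_colour:
  assumes "spath E A u v n" "\<And>a b. a \<in> A \<Longrightarrow> b \<in> A \<Longrightarrow> E a b \<Longrightarrow> col a \<noteq> (col b :: bool)"
  shows "odd n \<longleftrightarrow> col u \<noteq> col v"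
  using assms
proof (induction rule: spath_induct)
  case (step u A v w n)
  have "v \<in> A" using spath_endpoints(1)[OF step(3)] by auto
  then have "col u \<noteq> col v" using step by auto
  moreover have "odd n \<longleftrightarrow> col v \<noteq> col w" using step by auto
  ultimately show ?case by auto
qed auto

section \<open>Graphs with a separating pair of vertices\<close>

text \<open>The cycle is given as two paths meeting at most in their ends; \<open>3 \<le> n\<close>
  rules out one edge traversed twice.\<close>

definition cycle_length :: "('a \<Rightarrow> 'a \<Rightarrow> bool) \<Rightarrow> nat \<Rightarrow> bool" where
  "cycle_length E n \<longleftrightarrow> 3 \<le> n \<and> (\<exists>x y A B j k. x \<noteq> y \<and> spath E A x y j \<and> spath E B y x k \<and>
     A \<inter> B \<subseteq> {x, y} \<and> n = j + k)"

lemma cycle_lengthI: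
  "x \<noteq> y \<Longrightarrow> spath E A x y j \<Longrightarrow> spath E B y x k \<Longrightarrow> A \<inter> B \<subseteq> {x, y} \<Longrightarrow> 3 \<le> j + k \<Longrightarrow>
    cycle_length E (j + k)"
  unfolding cycle_length_def by blast

locale separating_pair =
  fixes V :: "'a set" and E :: "'a \<Rightarrow> 'a \<Rightarrow> bool" and x y :: 'a and A B :: "'a set" and m :: nat
  assumes finV: "finite V" and symE: "symp E" and irrE: "irreflp E"
    and V_eq: "V = A \<union> B \<union> {x, y}" and AB: "A \<inter> B = {}" "A \<noteq> {}" "B \<noteq> {}"
    and xy: "x \<noteq> y" "x \<notin> A \<union> B" "y \<notin> A \<union> B"
    and no_edge: "\<And>a b. a \<in> A \<Longrightarrow> b \<in> B \<Longrightarrow> \<not> E a b"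
    and degree: "\<And>v. v \<in> V \<Longrightarrow> 2 * m \<le> card (nbrs V E v)"
    and connected2: "\<And>S q. S \<subseteq> V - {q} \<Longrightarrow> S \<noteq> {} \<Longrightarrow> S \<noteq> V - {q} \<Longrightarrow>
      \<exists>u\<in>S. \<exists>t\<in>V - S. t \<noteq> q \<and> E u t"
begin

lemma swap: "separating_pair V E x y B A m"
  using finV symE irrE V_eq AB xy no_edge degree connected2
  by unfold_locales (auto dest: sympD)

text \<open>Without the edge \<open>xy\<close> the roots are nonadjacent, as
  \<open>rooted_graph\<close> demands, and every side path has length at least 2, so closing it
  gives a genuine cycle.\<close>

definition F :: "'a \<Rightarrow> 'a \<Rightarrow> bool" where
  "F u v \<longleftrightarrow> E u v \<and> {u, v} \<noteq> {x, y}"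

lemma F_imp_E: "F u v \<Longrightarrow> E u v"
  unfolding F_def by auto

lemma nbrs_side:
  assumes "u \<in> A" "t \<in> V" "E u t"
  shows "t \<in> A \<union> {x, y}" "F u t"
  using assms no_edge V_eq xy unfolding F_def by (auto simp: doubleton_eq_iff)

lemma F_sym_irr: "symp F" "irreflp F"
  using symE irrE unfolding F_def
  by (auto intro!: sympI irreflpI dest: sympD irreflpD simp: insert_commute)

lemma side_rooted: "rooted (A \<union> {x, y}) F x y"
  unfolding rooted_def
proof (intro allI impI)
  fix S q assume S: "S \<subseteq> A \<union> {x, y} - {x, y}" "S \<noteq> {}"
  then have SA: "S \<subseteq> A" by auto
  \<comment> \<open>If \<open>q\<close> lies in \<open>S\<close>, avoiding it is automatic, and
    2-connectivity is applied with \<open>x\<close>, which is outside \<open>S\<close>.\<close>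
  define q' where "q' = (if q \<in> S then x else q)"
  have q': "q' \<notin> S" using SA xy unfolding q'_def by auto
  have "S \<noteq> V - {q'}" using SA xy V_eq by auto
  moreover have "S \<subseteq> V - {q'}" using SA V_eq q' by auto
  ultimately obtain u t where ut: "u \<in> S" "t \<in> V - S" "t \<noteq> q'" "E u t"
    using connected2 S(2) by metis
  then have "t \<in> A \<union> {x, y} - S" "F u t" using nbrs_side[of u t] SA by auto
  moreover have "t \<noteq> q" using ut unfolding q'_def by (auto split: if_splits)
  ultimately show "\<exists>u\<in>S. \<exists>t\<in>A \<union> {x, y} - S. t \<noteq> q \<and> F u t" using ut by auto
qed

lemma side_prog:
  obtains l where "\<And>i. i < m \<Longrightarrow> spath F (A \<union> {x, y}) x y (l + 2 * i)"
proof -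
  let ?V = "A \<union> {x, y}"
  have "2 * m \<le> card (nbrs ?V F v)" if "v \<in> ?V - {x, y}" for v
  proof -
    have "v \<in> A" "v \<in> V" using that V_eq by auto
    then have "nbrs ?V F v = nbrs V E v"
      using nbrs_side[of v] V_eq F_imp_E unfolding nbrs_def by blast
    then show ?thesis using degree \<open>v \<in> V\<close> by auto
  qed
  moreover have "finite ?V" "?V \<noteq> {x, y}" using finV V_eq AB xy by auto
  ultimately have "rooted_graph ?V F x y m"
    unfolding rooted_graph_def using side_rooted F_sym_irr xy by (auto simp: F_def)
  from rooted_graph_shared_paths[OF this] obtain g where
    g: "g \<in> ?V - {y}" "F g y" "prog_paths F (?V - {y}) x g m"
    unfolding shared_paths_def by auto
  have "spath F {g, y} g y 1" using g by (intro spath_edge) auto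
  from prog_paths_append[OF g(3) this] have "prog_paths F (?V - {y} \<union> {g, y}) x y m" by auto
  then have "prog_paths F ?V x y m" by (rule prog_paths_mono) (use g in auto)
  then show ?thesis using that unfolding prog_paths_def by auto
qed

lemma F_path_length: "spath F W x y n \<Longrightarrow> 2 \<le> n"
proof (erule spath_cases)
  fix v k assume "n = Suc k" "F x v" "spath F (W - {x}) v y k"
  then show "2 \<le> n" using spath_cases[of F "W - {x}" v y k] unfolding F_def by fastforce
qed (use xy in auto)

lemma cycle_of_sides:
  assumes "spath F (A \<union> {x, y}) x y j" "spath F (B \<union> {x, y}) x y k"
  shows "cycle_length E (j + k)"
proof -
  have 1: "spath E (A \<union> {x, y}) x y j" "spath E (B \<union> {x, y}) x y k"
    using assms F_imp_E by (auto elim: spath_mono_rel)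
  have "(A \<union> {x, y}) \<inter> (B \<union> {x, y}) \<subseteq> {x, y}" using AB by auto
  moreover have "2 \<le> j" "2 \<le> k" using assms F_path_length by auto
  ultimately show ?thesis using cycle_lengthI[OF xy(1) 1(1) spath_rev[OF symE 1(2)]] by auto
qed

lemma cycle_of_edge:
  assumes "spath F (A \<union> {x, y}) x y j" "E x y"
  shows "cycle_length E (j + 1)"
proof -
  have "spath E (A \<union> {x, y}) x y j" using assms F_imp_E by (auto elim: spath_mono_rel)
  moreover have "spath E {y, x} y x 1" using assms symE xy by (intro spath_edge) (auto dest: sympD)
  moreover have "2 \<le> j" using assms F_path_length by auto
  ultimately show ?thesis using xy(1) by (intro cycle_lengthI) auto
qed

lemma side_colouring_or_parities:
  obtains (colouring) col :: "'a \<Rightarrow> bool" where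
    "\<And>u v. u \<in> A \<union> {x, y} \<Longrightarrow> v \<in> A \<union> {x, y} \<Longrightarrow> F u v \<Longrightarrow> col u \<noteq> col v" "\<not> col x"
  | (parities) "\<And>b. \<exists>n. spath F (A \<union> {x, y}) x y n \<and> (odd n \<longleftrightarrow> b)"
proof (rule rooted_colouring_or_parities[OF _ _ _ _ F_sym_irr side_rooted])
  fix col :: "'a \<Rightarrow> bool"
  assume "\<And>u v. u \<in> A \<union> {x, y} \<Longrightarrow> v \<in> A \<union> {x, y} \<Longrightarrow> F u v \<Longrightarrow> col u \<noteq> col v"
  then show thesis by (intro colouring[of "\<lambda>u. col u \<noteq> col x"]) auto
qed (use parities finV V_eq xy in auto)

section \<open>Closing path families to odd cycles\<close>

text \<open>The side \<open>B\<close> supplies one path of the parity opposite to \<open>l\<close>,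
  which closes every member of the family of \<open>A\<close>.\<close>

lemma odd_cycles_of_parities:
  assumes "\<And>b. \<exists>n. spath F (B \<union> {x, y}) x y n \<and> (odd n \<longleftrightarrow> b)"
  shows "\<exists>l. odd l \<and> (\<forall>i<m. cycle_length E (l + 2 * i))"
proof -
  obtain l where l: "\<And>i. i < m \<Longrightarrow> spath F (A \<union> {x, y}) x y (l + 2 * i)" using side_prog by metis
  obtain n where n: "spath F (B \<union> {x, y}) x y n" "odd n \<longleftrightarrow> even l" using assms by blast
  have "cycle_length E (l + n + 2 * i)" if "i < m" for i
    using cycle_of_sides[OF l[OF that] n(1)] by (simp add: algebra_simps)
  moreover have "odd (l + n)" using n(2) by auto
  ultimately show ?thesis by blast
qed

lemma odd_cycles:
  assumes pos: "0 < m" and nonbip: "\<And>col :: 'a \<Rightarrow> bool. \<exists>u\<in>V. \<exists>v\<in>V. E u v \<and> col u = col v"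
  shows "\<exists>l. odd l \<and> (\<forall>i<m. cycle_length E (l + 2 * i))"
proof -
  interpret swap: separating_pair V E x y B A m by (rule swap)
  show ?thesis
  proof (cases rule: swap.side_colouring_or_parities)
    case parities
    then show ?thesis by (rule odd_cycles_of_parities)
  next
    case colB: (colouring cB)
    show ?thesis
    proof (cases rule: side_colouring_or_parities)
      case parities
      then show ?thesis using swap.odd_cycles_of_parities by auto
    next
      case colA: (colouring cA)
      obtain l where l: "\<And>i. i < m \<Longrightarrow> spath F (A \<union> {x, y}) x y (l + 2 * i)"
        using side_prog by metis
      have parA: "odd n \<longleftrightarrow> cA y" if "spath F (A \<union> {x, y}) x y n" for n
        using spath_colour[of F "A \<union> {x, y}" x y n cA] that colA by auto
      have parB: "odd n \<longleftrightarrow> cB y" if "spath F (B \<union> {x, y}) x y n" for n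
        using spath_colour[of F "B \<union> {x, y}" x y n cB] that colB by auto
      have parl: "odd l \<longleftrightarrow> cA y" using parA[OF l[of 0]] pos by simp
      show ?thesis
      proof (cases "cA y = cB y")
        case False
        \<comment> \<open>The sides force different parities, so any single path through
          \<open>B\<close> closes the family of \<open>A\<close> to odd cycles.\<close>
        have "B \<union> {x, y} \<noteq> {x, y}" using AB(3) xy by auto
        then obtain n where n: "n \<in> B \<union> {x, y}" "n \<noteq> x" "n \<noteq> y" "F n y"
          using rooted_nbr[OF swap.side_rooted] by blast
        then have "joined F (B \<union> {x, y} - {y}) x n" "n \<in> B"
          using rooted_joined[OF swap.side_rooted F_sym_irr(1) _ xy(1)] by auto
        then obtain k where k: "spath F (B \<union> {x, y} - {y}) x n k" unfolding joined_def by auto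
        have "spath F {n, y} n y 1" using n by (intro spath_edge) auto
        from spath_append[OF k this] have "spath F ((B \<union> {x, y} - {y}) \<union> {n, y}) x y (k + 1)" by auto
        then have "spath F (B \<union> {x, y}) x y (k + 1)" by (rule spath_mono) (use \<open>n \<in> B\<close> in auto)
        then have k': "spath F (B \<union> {x, y}) x y (k + 1)" "odd (k + 1) \<longleftrightarrow> cB y" using parB by blast+
        have "cycle_length E (l + (k + 1) + 2 * i)" if "i < m" for i
          using cycle_of_sides[OF l[OF that] k'(1)] by (simp add: algebra_simps)
        moreover have "odd (l + (k + 1))" using parl k'(2) False by auto
        ultimately show ?thesis by blast
      next
        case True
        \<comment> \<open>The two colourings agree at \<open>x\<close> and \<open>y\<close> and
          combine to one of the whole graph; only an edge \<open>xy\<close> with ends of equal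
          colour can spoil it.\<close>
        have "E x y \<and> \<not> cA y"
        proof (rule ccontr)
          assume neg: "\<not> ?thesis"
          define col where "col u = (if u \<in> A then cA u else cB u)" for u
          have cA: "col u = cA u" if "u \<in> A \<union> {x, y}" for u
            using that xy colA(2) colB(2) True unfolding col_def by auto
          have cB: "col u = cB u" if "u \<in> B \<union> {x, y}" for u
            using that xy AB unfolding col_def by auto
          obtain u v where uv: "u \<in> V" "v \<in> V" "E u v" "col u = col v" using nonbip by blast
          have "F u v"
            using uv neg colA(2) cA[of x] cA[of y] symE irrE
            unfolding F_def by (auto simp: doubleton_eq_iff dest: sympD irreflpD)
          moreover have "u \<in> A \<union> {x, y} \<and> v \<in> A \<union> {x, y} \<or> u \<in> B \<union> {x, y} \<and> v \<in> B \<union> {x, y}"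
            using uv no_edge[of u v] no_edge[of v u] symE V_eq by (auto dest: sympD)
          ultimately show False using colA(1)[of u v] colB(1)[of u v] cA cB uv(4) by auto
        qed
        then have "cycle_length E (l + 1 + 2 * i)" if "i < m" for i
          using cycle_of_edge[OF l[OF that]] by (simp add: algebra_simps)
        moreover have "odd (l + 1)" using parl \<open>E x y \<and> \<not> cA y\<close> by auto
        ultimately show ?thesis by blast
      qed
    qed
  qed
qed

end

section \<open>Translation to digraphs\<close>

lemma spath_imp_pawalk:
  assumes "spath E A u v n" "\<And>a b. E a b \<Longrightarrow> (a, b) \<in> R"
  shows "\<exists>p. length p = n \<and> pcas u p v \<and> set p \<subseteq> R \<and> distinct (pawalk_verts u p) \<and>
    set (pawalk_verts u p) \<subseteq> A"
  using assms(1)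
proof (induction rule: spath_induct)
  case (refl u A)
  then show ?case by (intro exI[of _ "[]"]) auto
next
  case (step u A v w n)
  then obtain p where "length p = n" "pcas v p w" "set p \<subseteq> R" "distinct (pawalk_verts v p)"
    "set (pawalk_verts v p) \<subseteq> A - {u}" by auto
  then show ?case using step assms(2) by (intro exI[of _ "(u, v) # p"]) auto
qed

lemma pawalk_verts_append:
  "pcas u p v \<Longrightarrow> pcas v q w \<Longrightarrow> pawalk_verts u (p @ q) = pawalk_verts u p @ tl (pawalk_verts v q)"
proof (induction p arbitrary: u)
  case Nil
  then show ?case by (cases q) auto
qed auto

lemma pawalk_verts_Cons: "pcas u p v \<Longrightarrow> pawalk_verts u p = u # tl (pawalk_verts u p)"
  by (cases p) auto

lemma pcas_append: "pcas u p v \<Longrightarrow> pcas v q w \<Longrightarrow> pcas u (p @ q) w"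
  by (induction p arbitrary: u) auto

text \<open>Dropping the first entry removes \<open>x\<close> from the first vertex list and
  \<open>y\<close> from the second, so the remaining lists are disjoint and the concatenated walk
  repeats no vertex but its start.\<close>

lemma cycle_length_imp_has_cycle:
  assumes G: "pair_graph G" and "cycle_length (\<lambda>u v. (u, v) \<in> parcs G) n"
  shows "has_cycle_of_length (with_proj G) n"
proof -
  interpret pair_graph G by (rule G)
  let ?E = "\<lambda>u v. (u, v) \<in> parcs G"
  obtain x y A B j k where c: "3 \<le> n" "x \<noteq> y" "spath ?E A x y j" "spath ?E B y x k"
    "A \<inter> B \<subseteq> {x, y}" "n = j + k"
    using assms(2) unfolding cycle_length_def by blast
  obtain p where p: "length p = j" "pcas x p y" "set p \<subseteq> parcs G" "distinct (pawalk_verts x p)"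
    "set (pawalk_verts x p) \<subseteq> A"
    using spath_imp_pawalk[OF c(3), of "parcs G"] by auto
  obtain q where q: "length q = k" "pcas y q x" "set q \<subseteq> parcs G" "distinct (pawalk_verts y q)"
    "set (pawalk_verts y q) \<subseteq> B"
    using spath_imp_pawalk[OF c(4), of "parcs G"] by auto
  have P: "pawalk_verts x p = x # tl (pawalk_verts x p)" and Q: "pawalk_verts y q = y # tl (pawalk_verts y q)"
    using pawalk_verts_Cons p q by metis+
  have dp: "distinct (tl (pawalk_verts x p))" "x \<notin> set (tl (pawalk_verts x p))"
    "set (tl (pawalk_verts x p)) \<subseteq> A"
    using p(4,5) P by (metis distinct.simps(2), metis distinct.simps(2), metis set_subset_Cons subset_trans)
  have dq: "distinct (tl (pawalk_verts y q))" "y \<notin> set (tl (pawalk_verts y q))"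
    "set (tl (pawalk_verts y q)) \<subseteq> B"
    using q(4,5) Q by (metis distinct.simps(2), metis distinct.simps(2), metis set_subset_Cons subset_trans)
  have tl: "tl (pawalk_verts x (p @ q)) = tl (pawalk_verts x p) @ tl (pawalk_verts y q)"
    using pawalk_verts_append[OF p(2) q(2)] P by (metis append_Cons list.sel(3))
  have "distinct (tl (pawalk_verts x (p @ q)))"
    unfolding tl distinct_append using dp dq c(5) by blast
  moreover have "p \<noteq> []" using p c(2) by auto
  moreover have "x \<in> pverts G" using p \<open>p \<noteq> []\<close> by (cases p) (auto intro: in_arcsD1)
  moreover have "pcas x (p @ q) x" using p q pcas_append by metis
  ultimately have "cycle (p @ q)"
    unfolding cycle_def awalk_def using p(3) q(3) by (intro exI[of _ x] conjI) simp_all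
  then show ?thesis unfolding has_cycle_of_length_def using c p q by (intro conjI exI[of _ "p @ q"]) auto
qed

text \<open>The set of vertices reachable from a given one has no leaving edge; conversely a set
  without leaving edges traps reachability. This is the cut form used by
  \<open>separating_pair\<close>.\<close>

lemma connected_induced_iff:
  assumes G: "pair_graph G"
  shows "connected (with_proj G \<restriction> W) \<longleftrightarrow>
    W \<noteq> {} \<and> (\<forall>A\<subset>W. A \<noteq> {} \<longrightarrow> (\<exists>u\<in>A. \<exists>t\<in>W - A. (u, t) \<in> parcs G))"
proof -
  interpret pair_graph G by (rule G)
  define M where "M = mk_symmetric (with_proj G \<restriction> W)"
  have sym: "(v, u) \<in> parcs G" if "(u, v) \<in> parcs G" for u v
    using that pair_sym_arcs unfolding symmetric_def by (auto dest: symD)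
  have M: "pverts M = W" "parcs M = {(u, v) \<in> parcs G. u \<in> W \<and> v \<in> W}"
    unfolding M_def using sym by (auto simp: parcs_mk_symmetric)
  interpret M: pair_wf_digraph M by unfold_locales (auto simp: M)
  have "strongly_connected (with_proj M) \<longleftrightarrow>
    W \<noteq> {} \<and> (\<forall>A\<subset>W. A \<noteq> {} \<longrightarrow> (\<exists>u\<in>A. \<exists>t\<in>W - A. (u, t) \<in> parcs G))" (is "?L \<longleftrightarrow> ?R")
  proof
    assume L: ?L
    have "\<exists>u\<in>A. \<exists>t\<in>W - A. (u, t) \<in> parcs G" if A: "A \<subset> W" "A \<noteq> {}" for A
    proof (rule ccontr)
      assume neg: "\<not> ?thesis"
      obtain u v where uv: "u \<in> A" "v \<in> W - A" using A by auto
      then have "u \<rightarrow>\<^sup>*\<^bsub>with_proj M\<^esub> v" using L A unfolding strongly_connected_def M by (auto simp: M)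
      then have "v \<in> A"
      proof (induction rule: M.reachable_induct)
        case (step s t)
        then show ?case using neg M by auto
      qed (use uv in auto)
      then show False using uv by auto
    qed
    moreover have "W \<noteq> {}" using L M unfolding strongly_connected_def by auto
    ultimately show ?R by auto
  next
    assume R: ?R
    have "u \<rightarrow>\<^sup>*\<^bsub>with_proj M\<^esub> v" if uv: "u \<in> W" "v \<in> W" for u v
    proof (rule ccontr)
      assume neg: "\<not> ?thesis"
      define A where "A = {t \<in> W. u \<rightarrow>\<^sup>*\<^bsub>with_proj M\<^esub> t}"
      have "u \<in> A" using uv M unfolding A_def by (auto intro: M.reachable_refl)
      moreover have "v \<notin> A" using neg unfolding A_def by auto
      ultimately have "A \<subset> W" "A \<noteq> {}" using uv unfolding A_def by auto
      then obtain s t where st: "s \<in> A" "t \<in> W - A" "(s, t) \<in> parcs G" using R by blast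
      then have "(s, t) \<in> parcs M" using M unfolding A_def by auto
      then have "u \<rightarrow>\<^sup>*\<^bsub>with_proj M\<^esub> t" using st M.reachable_adj_trans[of u s t] unfolding A_def by auto
      then show False using st unfolding A_def by auto
    qed
    then show ?L using R M unfolding strongly_connected_def by auto
  qed
  then show ?thesis unfolding connected_def M_def .
qed

lemma out_degree_eq_card_nbrs:
  assumes "pair_graph G"
  shows "out_degree (with_proj G) v = card (nbrs (pverts G) (\<lambda>u w. (u, w) \<in> parcs G) v)"
proof -
  interpret pair_graph G by (rule assms)
  have "out_arcs (with_proj G) v = Pair v ` nbrs (pverts G) (\<lambda>u w. (u, w) \<in> parcs G) v"
    unfolding out_arcs_def nbrs_def by (auto dest: in_arcsD2)
  then show ?thesis unfolding out_degree_def by (simp add: card_image inj_on_def)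
qed

theorem theorem1p4:
  fixes G :: "'a pair_pre_digraph" and k :: nat
  assumes "1 \<le> k"
    and "pair_graph G"
    and "vertex_connected 2 (with_proj G)"
    and "\<not> bipartite (with_proj G)"
    and "\<not> vertex_connected 3 (with_proj G)"
    and "k + 1 \<le> min_degree (with_proj G)"
  shows "\<exists>l :: nat. odd l \<and>
    (\<forall>i < nat \<lceil>real k / 2\<rceil>. has_cycle_of_length (with_proj G) (l + 2 * i))"
proof -
  interpret pair_graph G by (rule assms)
  define V where "V = pverts G"
  define E where "E = (\<lambda>u v. (u, v) \<in> parcs G)"
  define m where "m = nat \<lceil>real k / 2\<rceil>"
  have m: "2 * m \<le> k + 1" "0 < m" using assms(1) unfolding m_def by linarith+
  have finV: "finite V" unfolding V_def by (rule pair_finite_verts)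
  have symE: "symp E"
    using pair_sym_arcs unfolding E_def symmetric_def by (auto intro!: sympI dest: symD)
  have irrE: "irreflp E" unfolding E_def by (auto intro!: irreflpI dest: pair_no_loops)
  have E_V: "E u v \<Longrightarrow> u \<in> V \<and> v \<in> V" for u v unfolding E_def V_def by (auto dest: wellformed')
  have card2: "2 < card V"
    and conn: "\<And>S. S \<subseteq> V \<Longrightarrow> card S < 2 \<Longrightarrow> connected (with_proj G \<restriction> (V - S))"
    using assms(3) unfolding vertex_connected_def V_def by auto
  have degree: "k + 1 \<le> card (nbrs V E v)" if "v \<in> V" for v
  proof -
    have "min_degree (with_proj G) \<le> out_degree (with_proj G) v"
      using that finV unfolding min_degree_def V_def by (intro Min_le) auto
    then show ?thesis using assms(6) out_degree_eq_card_nbrs[OF assms(2), of v]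
      unfolding V_def E_def by simp
  qed
  have nonbip: "\<exists>u\<in>V. \<exists>v\<in>V. E u v \<and> col u = col v" for col :: "'a \<Rightarrow> bool"
  proof (rule ccontr)
    assume neg: "\<not> ?thesis"
    have "{v \<in> V. col v} \<union> {v \<in> V. \<not> col v} = pverts G" unfolding V_def by auto
    moreover have "parcs G \<subseteq> {v \<in> V. col v} \<times> {v \<in> V. \<not> col v} \<union> {v \<in> V. \<not> col v} \<times> {v \<in> V. col v}"
      using neg E_V unfolding E_def by auto
    ultimately have "bipartite (with_proj G)" unfolding bipartite_def
      by (intro exI[of _ "{v \<in> V. col v}"] exI[of _ "{v \<in> V. \<not> col v}"]) auto
    then show False using assms(4) by auto
  qed
  have "\<exists>l. odd l \<and> (\<forall>i<m. cycle_length E (l + 2 * i))"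
  proof (cases "card V = 3")
    \<comment> \<open>With three vertices, 3-connectivity fails by size alone and yields no
      separating pair; here the degrees force a triangle and \<open>m = 1\<close>.\<close>
    case True
    then obtain a b c where V3: "V = {a, b, c}" "a \<noteq> b" "b \<noteq> c" "a \<noteq> c"
      using card_3_iff by metis
    have all: "E u v" if uv: "u \<in> V" "v \<in> V" "u \<noteq> v" for u v
    proof (rule ccontr)
      assume "\<not> E u v"
      then have "nbrs V E u \<subseteq> V - {u, v}" using irrE unfolding nbrs_def by (auto dest: irreflpD)
      then have "card (nbrs V E u) \<le> card (V - {u, v})" using finV by (intro card_mono) auto
      also have "\<dots> = 1" using uv True finV by (simp add: card_Diff_subset)
      finally show False using degree[OF uv(1)] assms(1) by auto
    qed
    have "nbrs V E a \<subseteq> {b, c}" using V3 irrE unfolding nbrs_def by (auto dest: irreflpD)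
    then have "card (nbrs V E a) \<le> card {b, c}" by (intro card_mono) auto
    then have "m \<le> 1" using degree[of a] V3 m by auto
    moreover have "cycle_length E 3"
    proof -
      have ab: "spath E {a, b} a b 1" and bc: "spath E {b, c} b c 1" and ca: "spath E {c, a} c a 1"
        using V3 by (intro spath_edge all; simp)+
      have "spath E ({b, c} \<union> {c, a}) b a (1 + 1)"
        using spath_append[OF bc ca] V3 by auto
      then show ?thesis using cycle_lengthI[OF V3(2) ab, of _ "1 + 1"]
        by (auto simp: numeral_3_eq_3)
    qed
    ultimately have "cycle_length E (3 + 2 * i)" if "i < m" for i using that by (cases i) auto
    moreover have "odd (3 :: nat)" by simp
    ultimately show ?thesis by blast
  next
    case False
    then have "3 < card V" using card2 by auto
    then obtain S where S: "S \<subseteq> V" "card S < 3" "\<not> connected (with_proj G \<restriction> (V - S))"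
      using assms(5) unfolding vertex_connected_def V_def by auto
    then have "card S = 2" using conn[of S] by (cases "card S < 2") auto
    then obtain x y where xy: "S = {x, y}" "x \<noteq> y" by (metis card_2_iff)
    have "V - S \<noteq> {}"
    proof
      assume "V - S = {}"
      then have "card V \<le> card S" using S finV by (intro card_mono) (auto intro: finite_subset)
      then show False using S \<open>3 < card V\<close> by auto
    qed
    then obtain A where A: "A \<subset> V - S" "A \<noteq> {}" "\<And>u t. u \<in> A \<Longrightarrow> t \<in> V - S - A \<Longrightarrow> \<not> E u t"
      using S(3) connected_induced_iff[OF assms(2), of "V - S"] unfolding E_def by blast
    have conn2: "\<exists>u\<in>T. \<exists>t\<in>V - T. t \<noteq> q \<and> E u t"
      if T: "T \<subseteq> V - {q}" "T \<noteq> {}" "T \<noteq> V - {q}" for T q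
    proof -
      \<comment> \<open>\<open>q\<close> may lie outside \<open>V\<close>, whereas
        \<open>conn\<close> speaks of subsets of \<open>V\<close>.\<close>
      have "V - ({q} \<inter> V) = V - {q}" by auto
      then have "connected (with_proj G \<restriction> (V - {q}))"
        using conn[of "{q} \<inter> V"] card_mono[of "{q}" "{q} \<inter> V"] by auto
      then obtain u t where "u \<in> T" "t \<in> V - {q} - T" "E u t"
        using T connected_induced_iff[OF assms(2), of "V - {q}"] unfolding E_def by blast
      then show ?thesis by auto
    qed
    interpret separating_pair V E x y A "V - S - A" m
    proof unfold_locales
      show "2 * m \<le> card (nbrs V E v)" if "v \<in> V" for v using degree[OF that] m by auto
    qed (use finV symE irrE A S xy conn2 in auto)
    show ?thesis by (rule odd_cycles[OF m(2) nonbip])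
  qed
  then obtain l where "odd l" "\<forall>i<m. cycle_length E (l + 2 * i)" by auto
  then show ?thesis
    using cycle_length_imp_has_cycle[OF assms(2)] unfolding E_def m_def by blast
qed

end
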